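(* Let $x_1, x_2, x_3$ be integers with $x_i > 4$ and $x_i \equiv i \pmod 4$ for $i = 1,2,3$ (no ordering among $x_1,x_2,x_3$ is assumed). Let $S = \langle 4, x_1, x_2, x_3\rangle$ be the numerical semigroup generated by $4, x_1, x_2, x_3$, which has multiplicity $4$, and suppose that $S$ has embedding dimension $4$ (so that the strict inequalities $x_1 + x_2 > x_3$, $x_3 + x_2 > x_1$, $2x_1 > x_2$, $2x_3 > x_2$ all hold). Then $S$ has minimal embedding dimension $3$ if and only if both of the following conditions hold: (a) $\max(x_1, x_2, x_3) \neq x_2$; (b) $\max(x_1, x_2, x_3) > 2\min(x_1, x_2, x_3)$.
   Context: A numerical semigroup is a subset $S \subset \mathbb{N} = \{0,1,2,\ldots\}$ that contains $0$, is closed under addition, and has finite complement in $\mathbb{N}$. For positive integers $n_1,\ldots,n_k$, $\langle n_1, \ldots, n_k\rangle$ denotes the set of all sums $\sum_i k_i n_i$ with $k_i \in \mathbb{N}$. The multiplicity of $S$ is its smallest nonzero element. Every numerical semigroup has a unique generating set of smallest cardinality; this cardinality is called the embedding dimension of $S$. A curve is a (germ of a) non-constant analytic map $c: (\mathbb{C},0) \to (\mathbb{C}^d,0)$, with $c(0)=0$. It is well-parameterized if it is one-to-one when restricted to a sufficiently small neighborhood of $0$. For a nonzero convergent power series $f(t) = \sum_{i\ge 0} a_i t^i \in \mathbb{C}\{t\}$, $\mathrm{ord}(f)$ is the smallest $i$ with $a_i \neq 0$. The semigroup of a well-parameterized curve $c$ is the set $$\{\mathrm{ord}(p\circ c) :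 p \in \mathbb{C}\{x_1,\ldots,x_d\},\ p\circ c \neq 0\} \subset \mathbb{N},$$ where $\mathbb{C}\{x_1,\ldots,x_d\}$ is the ring of power series converging in some neighborhood of $0\in\mathbb{C}^d$; it is a numerical semigroup. The minimal embedding dimension of a numerical semigroup $S$ is the smallest $d$ such that $S$ is the semigroup of some well-parameterized analytic curve germ $(\mathbb{C},0)\to(\mathbb{C}^d,0)$. *)

theory Defs
  imports "HOL-Complex_Analysis.Complex_Analysis" "HOL-Number_Theory.Cong"
begin

definition numerical_semigroup :: "nat set \<Rightarrow> bool" where
  "numerical_semigroup S \<longleftrightarrow>
     0 \<in> S \<and> (\<forall>a\<in>S. \<forall>b\<in>S. a + b \<in> S) \<and> finite (- S)"

(* Only meaningful for finite A: the sum over an infinite index set is 0. *)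
definition sg_gen :: "nat set \<Rightarrow> nat set" where
  "sg_gen A = {\<Sum>n\<in>A. k n * n | k :: nat \<Rightarrow> nat. True}"

definition multiplicity_sg :: "nat set \<Rightarrow> nat" where
  "multiplicity_sg S = (LEAST n. n \<in> S \<and> n \<noteq> 0)"

definition embedding_dim :: "nat set \<Rightarrow> nat" where
  "embedding_dim S = (LEAST k. \<exists>A. finite A \<and> 0 \<notin> A \<and> card A = k \<and> sg_gen A = S)"

(* The dimension d varies inside the definition of the minimal embedding dimension, so points
   of C^d are functions on nat of which only the values at i < d matter. Multi-indices are
   extensional functions on {..<d}, so that each monomial occurs exactly once. *)
definition multi_indices :: "nat \<Rightarrow> (nat \<Rightarrow> nat) set" where
  "multi_indices d = {..<d} \<rightarrow>\<^sub>E UNIV"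

(* A power series in d variables is given by its family of coefficients. *)
definition mps_term :: "nat \<Rightarrow> ((nat \<Rightarrow> nat) \<Rightarrow> complex) \<Rightarrow> (nat \<Rightarrow> complex) \<Rightarrow> (nat \<Rightarrow> nat) \<Rightarrow> complex" where
  "mps_term d p x \<alpha> = p \<alpha> * (\<Prod>i<d. x i ^ \<alpha> i)"

definition mps_convergent :: "nat \<Rightarrow> ((nat \<Rightarrow> nat) \<Rightarrow> complex) \<Rightarrow> bool" where
  "mps_convergent d p \<longleftrightarrow>
     (\<exists>r>0. \<forall>x. (\<forall>i<d. norm (x i) < r) \<longrightarrow> mps_term d p x summable_on multi_indices d)"

definition mps_eval :: "nat \<Rightarrow> ((nat \<Rightarrow> nat) \<Rightarrow> complex) \<Rightarrow> (nat \<Rightarrow> complex) \<Rightarrow> complex" where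
  "mps_eval d p x = (\<Sum>\<^sub>\<infinity>\<alpha>\<in>multi_indices d. mps_term d p x \<alpha>)"

(* A germ is given by a representative: c i is the i-th component, and only i < d and the
   behaviour near 0 matter. *)
definition curve :: "nat \<Rightarrow> (nat \<Rightarrow> complex \<Rightarrow> complex) \<Rightarrow> bool" where
  "curve d c \<longleftrightarrow>
     (\<forall>i<d. c i analytic_on {0} \<and> c i 0 = 0) \<and>
     \<not> (\<forall>\<^sub>F t in nhds 0. \<forall>i<d. c i t = 0)"

definition well_parameterized :: "nat \<Rightarrow> (nat \<Rightarrow> complex \<Rightarrow> complex) \<Rightarrow> bool" where
  "well_parameterized d c \<longleftrightarrow>
     (\<exists>r>0. inj_on (\<lambda>t. \<lambda>i\<in>{..<d}. c i t) (ball 0 r))"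

(* F is the Taylor series at 0 of the composition of p with c, and its order is subdegree F. *)
definition curve_semigroup :: "nat \<Rightarrow> (nat \<Rightarrow> complex \<Rightarrow> complex) \<Rightarrow> nat set" where
  "curve_semigroup d c =
     {subdegree F | p F. mps_convergent d p \<and>
        (\<lambda>t. mps_eval d p (\<lambda>i. c i t)) has_fps_expansion F \<and> F \<noteq> 0}"

definition min_embedding_dim :: "nat set \<Rightarrow> nat" where
  "min_embedding_dim S =
     (LEAST d. \<exists>c. curve d c \<and> well_parameterized d c \<and> curve_semigroup d c = S)"

lemma sg_gen_four:
  fixes x1 x2 x3 :: nat
  assumes "[x1 = 1] (mod 4)" "[x2 = 2] (mod 4)" "[x3 = 3] (mod 4)"
  shows "sg_gen {4, x1, x2, x3} = {a * 4 + b * x1 + c * x2 + d * x3 | a b c d. True}"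
proof -
  have ne: "x1 \<noteq> 4" "x2 \<noteq> 4" "x3 \<noteq> 4" "x1 \<noteq> x2" "x1 \<noteq> x3" "x2 \<noteq> x3"
    using assms by (auto simp: cong_def)
  have "\<exists>k. a * 4 + b * x1 + c * x2 + d * x3 = (\<Sum>n\<in>{4, x1, x2, x3}. k n * n)" for a b c d
    by (rule exI[of _ "\<lambda>n. if n = 4 then a else if n = x1 then b else if n = x2 then c else d"])
      (use ne ne[symmetric] in simp)
  moreover have "(\<Sum>n\<in>{4, x1, x2, x3}. k n * n) = k 4 * 4 + k x1 * x1 + k x2 * x2 + k x3 * x3" for k
    using ne ne[symmetric] by simp
  ultimately show ?thesis
    unfolding sg_gen_def by fastforce
qed

lemma numerical_semigroup_sg_gen_four:
  fixes x1 x2 x3 :: nat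
  assumes "[x1 = 1] (mod 4)" "[x2 = 2] (mod 4)" "[x3 = 3] (mod 4)"
  shows "numerical_semigroup (sg_gen {4, x1, x2, x3})"
proof -
  let ?S = "{a * 4 + b * x1 + c * x2 + d * x3 | a b c d. True}"
  have "0 \<in> ?S"
    by force
  moreover have "u + v \<in> ?S" if uv: "u \<in> ?S" "v \<in> ?S" for u v
  proof -
    obtain a b c d a' b' c' d' where
      "u = a * 4 + b * x1 + c * x2 + d * x3" "v = a' * 4 + b' * x1 + c' * x2 + d' * x3"
      using uv by blast
    then have "u + v = (a + a') * 4 + (b + b') * x1 + (c + c') * x2 + (d + d') * x3"
      by (simp add: algebra_simps)
    then show ?thesis
      by blast
  qed
  moreover have "- ?S \<subseteq> {..x1 + x2 + x3}"
  proof
    fix n assume n: "n \<in> - ?S"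
    show "n \<in> {..x1 + x2 + x3}"
    proof (rule ccontr)
      assume "n \<notin> {..x1 + x2 + x3}"
      then have big: "n > x1 + x2 + x3" by simp
      have "n mod 4 = 0 \<or> n mod 4 = 1 \<or> n mod 4 = 2 \<or> n mod 4 = 3" by linarith
      then obtain y where y: "y \<in> {0, x1, x2, x3}" "n mod 4 = y mod 4"
        using assms unfolding cong_def by fastforce
      then have "y \<le> n" using big by auto
      then have "4 dvd n - y" using y(2) mod_eq_dvd_iff_nat by metis
      then obtain k where "n - y = 4 * k" ..
      then have k: "n = k * 4 + y" using \<open>y \<le> n\<close> by simp
      have "n = k * 4 + 0 * x1 + 0 * x2 + 0 * x3 \<or> n = k * 4 + 1 * x1 + 0 * x2 + 0 * x3 \<or>
        n = k * 4 + 0 * x1 + 1 * x2 + 0 * x3 \<or> n = k * 4 + 0 * x1 + 0 * x2 + 1 * x3"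
        using y(1) k by auto
      then have "n \<in> ?S" by blast
      with n show False by simp
    qed
  qed
  then have "finite (- ?S)"
    using finite_subset by blast
  ultimately show ?thesis
    unfolding numerical_semigroup_def sg_gen_four[OF assms] by blast
qed

lemma multiplicity_sg_gen_four:
  fixes x1 x2 x3 :: nat
  assumes "[x1 = 1] (mod 4)" "[x2 = 2] (mod 4)" "[x3 = 3] (mod 4)"
    and "x1 > 4" "x2 > 4" "x3 > 4"
  shows "multiplicity_sg (sg_gen {4, x1, x2, x3}) = 4"
  unfolding multiplicity_sg_def
proof (rule Least_equality)
  have "(4::nat) = 1 * 4 + 0 * x1 + 0 * x2 + 0 * x3" by simp
  then have "4 \<in> sg_gen {4, x1, x2, x3}"
    unfolding sg_gen_four[OF assms(1-3)] by blast
  then show "4 \<in> sg_gen {4, x1, x2, x3} \<and> (4::nat) \<noteq> 0"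
    by simp
next
  fix n assume "n \<in> sg_gen {4, x1, x2, x3} \<and> n \<noteq> 0"
  then obtain a b c d where n: "n = a * 4 + b * x1 + c * x2 + d * x3" "n \<noteq> 0"
    unfolding sg_gen_four[OF assms(1-3)] by blast
  then have "a > 0 \<or> b > 0 \<or> c > 0 \<or> d > 0" by auto
  moreover have "b > 0 \<Longrightarrow> b * x1 \<ge> 4" "c > 0 \<Longrightarrow> c * x2 \<ge> 4" "d > 0 \<Longrightarrow> d * x3 \<ge> 4"
    using assms(4-6) mult_le_mono[of 1 _ 4] by fastforce+
  ultimately show "4 \<le> n" using n(1) by linarith
qed

lemma sg_gen_insert_redundant:
  assumes "finite B" "y \<notin> B" "y \<in> sg_gen B"
  shows "sg_gen (insert y B) = sg_gen B"
proof (intro equalityI subsetI)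
  obtain h where h: "y = (\<Sum>n\<in>B. h n * n)"
    using assms(3) unfolding sg_gen_def by blast
  fix u assume "u \<in> sg_gen (insert y B)"
  then obtain k where "u = (\<Sum>n\<in>insert y B. k n * n)"
    unfolding sg_gen_def by blast
  then have "u = k y * (\<Sum>n\<in>B. h n * n) + (\<Sum>n\<in>B. k n * n)"
    using assms(1,2) h by simp
  also have "\<dots> = (\<Sum>n\<in>B. (k y * h n + k n) * n)"
    by (simp add: sum_distrib_left sum.distrib algebra_simps)
  finally show "u \<in> sg_gen B"
    unfolding sg_gen_def by (intro CollectI exI[of _ "\<lambda>n. k y * h n + k n"]) simp
next
  fix u assume "u \<in> sg_gen B"
  then obtain k where k: "u = (\<Sum>n\<in>B. k n * n)"
    unfolding sg_gen_def by blast
  have "u = (\<Sum>n\<in>insert y B. (k(y := 0)) n * n)"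
    using k assms(1,2) by (auto intro!: sum.cong)
  then show "u \<in> sg_gen (insert y B)"
    unfolding sg_gen_def by blast
qed

lemma embedding_dim_le_if_redundant:
  assumes "finite B" "0 \<notin> B" "y \<notin> B" "y \<in> sg_gen B"
  shows "embedding_dim (sg_gen (insert y B)) \<le> card B"
  unfolding embedding_dim_def sg_gen_insert_redundant[OF assms(1,3,4)]
  by (rule Least_le) (use assms in blast)

lemma embedding_dim_four_imp:
  fixes x1 x2 x3 :: nat
  assumes cong: "[x1 = 1] (mod 4)" "[x2 = 2] (mod 4)" "[x3 = 3] (mod 4)"
    and dim: "embedding_dim (sg_gen {4, x1, x2, x3}) = 4"
  shows "x1 + x2 > x3" "x3 + x2 > x1" "2 * x1 > x2" "2 * x3 > x2"
proof -
  have False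
    if le: "a * p + b * q \<le> y" and m: "(a * p + b * q) mod 4 = y mod 4"
      and set: "{4, x1, x2, x3} = insert y {4, p, q}"
      and ne: "p \<noteq> q" "p mod 4 \<noteq> 0" "q mod 4 \<noteq> 0" "y mod 4 \<noteq> 0" "p \<noteq> y" "q \<noteq> y"
    for a b p q y :: nat
  proof -
    have "4 dvd y - (a * p + b * q)"
      by (rule iffD1[OF mod_eq_dvd_iff_nat[OF le] m[symmetric]])
    then obtain k where "y - (a * p + b * q) = 4 * k" ..
    then have k: "y = k * 4 + a * p + b * q" using le by simp
    have ne': "p \<noteq> 4" "q \<noteq> 4" "p \<noteq> 0" "q \<noteq> 0" "y \<noteq> 4" using ne by auto
    have "y = (\<Sum>n\<in>{4, p, q}. (if n = 4 then k else if n = p then a else b) * n)"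
      using ne ne' ne(1)[symmetric] ne'(1,2)[symmetric] by (subst k) simp
    then have "y \<in> sg_gen {4, p, q}"
      unfolding sg_gen_def
      by (intro CollectI exI[of _ "\<lambda>n. if n = 4 then k else if n = p then a else b"]) simp
    then have "embedding_dim (sg_gen (insert y {4, p, q})) \<le> card {4, p, q}"
      using ne' ne(5,6)[symmetric] by (intro embedding_dim_le_if_redundant) simp_all
    moreover have "card {4, p, q} \<le> 3"
      by (simp add: card_insert_if)
    ultimately show False
      using dim unfolding set by simp
  qed
  note contra = this
  have m: "x1 mod 4 = 1" "x2 mod 4 = 2" "x3 mod 4 = 3"
    using cong by (simp_all add: cong_def)
  have ne: "x1 \<noteq> x2" "x1 \<noteq> x3" "x2 \<noteq> x3" using m by auto
  have s: "(x1 + x2) mod 4 = 3" "(x3 + x2) mod 4 = 1" "(2 * x1) mod 4 = 2" "(2 * x3) mod 4 = 2"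
    using mod_add_eq[of x1 4 x2, symmetric] mod_add_eq[of x3 4 x2, symmetric]
      mod_mult_right_eq[of 2 x1 4, symmetric] mod_mult_right_eq[of 2 x3 4, symmetric]
    unfolding m by simp_all
  have set: "{4, x1, x2, x3} = insert x3 {4, x1, x2}" "{4, x1, x2, x3} = insert x1 {4, x3, x2}"
    "{4, x1, x2, x3} = insert x2 {4, x1, x3}" "{4, x1, x2, x3} = insert x2 {4, x3, x1}"
    by blast+
  show "x1 + x2 > x3"
    by (rule ccontr, rule contra[OF _ _ set(1), of 1 1]) (simp_all add: m s ne)
  show "x3 + x2 > x1"
    by (rule ccontr, rule contra[OF _ _ set(2), of 1 1]) (simp_all add: m s ne ne[symmetric])
  show "2 * x1 > x2"
    by (rule ccontr, rule contra[OF _ _ set(3), of 2 0]) (simp_all add: m s ne ne[symmetric])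
  show "2 * x3 > x2"
    by (rule ccontr, rule contra[OF _ _ set(4), of 2 0]) (simp_all add: m s ne ne[symmetric])
qed

end

theory Submission
  imports Defs
begin

unbundle no vec_syntax

text \<open>
  The orders occurring in the algebra of a curve are those of polynomials in the Taylor series of
  its components, since a power series may be truncated at high degree. Let \<open>f\<close> have order 4 and
  let \<open>\<mu> = Min {x1, x2, x3}\<close>. Modulo \<open>f m\<close>, where \<open>m\<close> is the maximal ideal, an element of \<open>m\<^sup>2\<close>
  has order at least \<open>2 \<mu>\<close>, so generators of the semigroup below \<open>2 \<mu>\<close> are not orders in \<open>m\<^sup>2\<close>, and elements
  with these orders are linearly independent in \<open>m / m\<^sup>2\<close>, whose dimension is at most the number of
  components. If the maximum is at most \<open>2 \<mu>\<close>, this excludes three components. It also excludes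
  two components, except when both odd generators exceed \<open>2 \<mu> = 2 x2\<close>; in that case the algebra is generated
  by \<open>f\<close> and some \<open>g\<close> of order \<open>x2\<close>, and reducing \<open>g\<^sup>2\<close> to an element \<open>h\<close> of odd order shows
  that the larger odd generator is at least the smaller one plus \<open>x2\<close>.

  Conversely, if the maximum \<open>z\<close> exceeds \<open>2 \<mu>\<close>, it is odd, and adding a term of odd order to \<open>t\<^bsup>x2\<^esup>\<close>
  deforms the relation expressing \<open>2 \<mu>\<close> by smaller generators so that it produces order \<open>z\<close>.
\<close>

section \<open>Orders of power series\<close>

definition orders :: "'a::zero fps set \<Rightarrow> nat set" where
  "orders A = subdegree ` (A - {0})"

lemma ordersI: "F \<in> A \<Longrightarrow> F \<noteq> 0 \<Longrightarrow> subdegree F \<in> orders A"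
  by (auto simp: orders_def)

lemma ordersE:
  assumes "n \<in> orders A"
  obtains F where "F \<in> A" "F \<noteq> 0" "subdegree F = n"
  using assms unfolding orders_def by blast

lemma fps_X_power_dvd_iff:
  fixes F :: "'a::field fps"
  shows "fps_X ^ n dvd F \<longleftrightarrow> (\<forall>k<n. F $ k = 0)"
proof (cases "F = 0")
  case False
  have "fps_X ^ n dvd F \<longleftrightarrow> n \<le> subdegree F"
    using fps_dvd_iff[of "fps_X ^ n" F] False by simp
  also have "\<dots> \<longleftrightarrow> (\<forall>k<n. F $ k = 0)"
  proof
    assume "n \<le> subdegree F"
    then show "\<forall>k<n. F $ k = 0"
      using nth_less_subdegree_zero order.strict_trans2 by blast
  next
    assume "\<forall>k<n. F $ k = 0"
    then show "n \<le> subdegree F"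
      using subdegree_geI[OF False, of n] by simp
  qed
  finally show ?thesis .
qed simp

lemma fps_X_power_dvd_mult:
  fixes F :: "'a::field fps"
  assumes "fps_X ^ m dvd F" "fps_X ^ n dvd G"
  shows "fps_X ^ (m + n) dvd F * G"
  unfolding power_add using assms by (rule mult_dvd_mono)

lemma fps_X_dvd_iff:
  fixes F :: "'a::field fps"
  shows "fps_X dvd F \<longleftrightarrow> F $ 0 = 0"
  using fps_X_power_dvd_iff[of 1 F] by (simp only: power_one_right less_one simp_thms)

text \<open>Truncation principle: the order is decided by the coefficients up to the order itself,
  so an approximation modulo a higher power of \<open>fps_X\<close> keeps it. Every later passage to
  an approximating series rests on this.\<close>

lemma subdegree_eq_of_dvd_diff:
  fixes F G :: "'a::field fps"
  assumes "fps_X ^ n dvd F - G" "F \<noteq> 0" "subdegree F < n"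
  shows "G \<noteq> 0" "subdegree G = subdegree F"
proof -
  have eq: "G $ k = F $ k" if "k < n" for k
    using assms(1) that unfolding fps_X_power_dvd_iff by simp
  then have nz: "G $ subdegree F \<noteq> 0"
    using assms(2,3) by simp
  then show "G \<noteq> 0" by auto
  show "subdegree G = subdegree F"
    by (rule subdegreeI) (use nz eq assms(3) in auto)
qed

lemma subdegree_add_distinct:
  fixes F G :: "'a::field fps"
  assumes "F \<noteq> 0" "G \<noteq> 0" "subdegree F \<noteq> subdegree G"
  shows "F + G \<noteq> 0" "subdegree (F + G) = min (subdegree F) (subdegree G)"
proof -
  have *: "subdegree (F + G) = min (subdegree F) (subdegree G)"
  proof (cases "subdegree F < subdegree G")
    case True
    then show ?thesis
      using subdegree_add_eq1[OF assms(1) True] by simp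
  next
    case False
    then have "subdegree G < subdegree F"
      using assms(3) by simp
    then show ?thesis
      using subdegree_add_eq2[OF assms(2)] by simp
  qed
  then show "subdegree (F + G) = min (subdegree F) (subdegree G)" .
  show "F + G \<noteq> 0"
  proof
    assume "F + G = 0"
    then have "F = - G"
      by (simp add: eq_neg_iff_add_eq_0)
    then show False
      using assms(3) by simp
  qed
qed

text \<open>The family is indexed by its own orders, so these are distinct. The leading term at the
  least index with a nonzero coefficient cannot be cancelled by the others.\<close>

lemma subdegree_combination:
  fixes F :: "nat \<Rightarrow> 'a::field fps"
  assumes "finite J" "\<And>j. j \<in> J \<Longrightarrow> F j \<noteq> 0 \<and> subdegree (F j) = j" "j0 \<in> J" "l j0 \<noteq> 0"
  defines "P \<equiv> \<Sum>j\<in>J. fps_const (l j) * F j"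
  shows "P \<noteq> 0" "subdegree P \<in> J"
proof -
  define n where "n = (LEAST j. j \<in> J \<and> l j \<noteq> 0)"
  have n: "n \<in> J" "l n \<noteq> 0"
    using LeastI[of "\<lambda>j. j \<in> J \<and> l j \<noteq> 0" j0] assms(3,4) unfolding n_def by blast+
  have below: "l j = 0" if "j \<in> J" "j < n" for j
    using not_less_Least[of j "\<lambda>j. j \<in> J \<and> l j \<noteq> 0"] that unfolding n_def by blast
  have P: "P $ k = (\<Sum>j\<in>J. l j * F j $ k)" for k
    by (simp add: P_def fps_sum_nth)
  have zero: "l j * F j $ k = 0" if "j \<in> J" "k \<le> n" "j \<noteq> k \<or> k < n" for j k
    using that below[of j] assms(2)[of j] nth_less_subdegree_zero[of k "F j"] by (cases "j < n") auto
  have "P $ n = (\<Sum>j\<in>{n}. l j * F j $ n)"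
    unfolding P by (rule sum.mono_neutral_right) (use assms(1) n zero in auto)
  moreover have "F n $ n \<noteq> 0"
    using assms(2)[OF n(1)] nth_subdegree_nonzero[of "F n"] by simp
  ultimately have nz: "P $ n \<noteq> 0"
    using n(2) by simp
  then show "P \<noteq> 0" by auto
  have "P $ k = 0" if "k < n" for k
    unfolding P using zero that by (intro sum.neutral ballI) simp
  with nz have "subdegree P = n"
    by (intro subdegreeI)
  with n show "subdegree P \<in> J" by simp
qed


section \<open>Subalgebras of power series and their maximal ideals\<close>

text \<open>Polynomial expressions in the elements of \<open>G\<close>, without completion; by
  truncation they have the same orders as convergent power series in them.\<close>

inductive_set subalg :: "'a::field fps set \<Rightarrow> 'a fps set" for G where
  const [simp, intro]: "fps_const a \<in> subalg G"
| gen [intro]: "F \<in> G \<Longrightarrow> F \<in> subalg G"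
| add [intro]: "F \<in> subalg G \<Longrightarrow> H \<in> subalg G \<Longrightarrow> F + H \<in> subalg G"
| mult [intro]: "F \<in> subalg G \<Longrightarrow> H \<in> subalg G \<Longrightarrow> F * H \<in> subalg G"

lemma subalg_0 [simp]: "0 \<in> subalg G" and subalg_1 [simp]: "1 \<in> subalg G"
  using subalg.const[of 0] subalg.const[of 1] by simp_all

lemma subalg_power [intro]: "F \<in> subalg G \<Longrightarrow> F ^ n \<in> subalg G"
  by (induction n) auto

lemma subalg_diff [intro]:
  assumes "F \<in> subalg G" "H \<in> subalg G"
  shows "F - H \<in> subalg G"
proof -
  have "F + fps_const (- 1) * H \<in> subalg G"
    using assms by blast
  then show ?thesis
    by (simp add: fps_const_neg[symmetric] del: fps_const_neg)
qed

lemma subalg_sum: "(\<And>x. x \<in> I \<Longrightarrow> F x \<in> subalg G) \<Longrightarrow> (\<Sum>x\<in>I. F x) \<in> subalg G"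
  by (induction I rule: infinite_finite_induct) auto

lemma subalg_prod: "(\<And>x. x \<in> I \<Longrightarrow> F x \<in> subalg G) \<Longrightarrow> (\<Prod>x\<in>I. F x) \<in> subalg G"
  by (induction I rule: infinite_finite_induct) auto

lemma orders_subalg_0: "0 \<in> orders (subalg G)"
  using ordersI[of 1 "subalg G"] by simp

lemma orders_subalg_add:
  "a \<in> orders (subalg G) \<Longrightarrow> b \<in> orders (subalg G) \<Longrightarrow> a + b \<in> orders (subalg G)"
  unfolding orders_def image_iff by (metis Diff_iff empty_iff insert_iff mult_eq_0_iff subalg.mult subdegree_mult)

lemma orders_subalg_mult: "a \<in> orders (subalg G) \<Longrightarrow> k * a \<in> orders (subalg G)"
  by (induction k) (auto intro: orders_subalg_0 orders_subalg_add)

definition max_ideal :: "'a::field fps set \<Rightarrow> 'a fps set" where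
  "max_ideal G = {F \<in> subalg G. F $ 0 = 0}"

text \<open>Finite sums of products, built one product at a time so that induction has to treat only
  a single \<open>u * w\<close>.\<close>

inductive_set max_ideal_sq :: "'a::field fps set \<Rightarrow> 'a fps set" for G where
  zero [simp, intro]: "0 \<in> max_ideal_sq G"
| step: "q \<in> max_ideal_sq G \<Longrightarrow> u \<in> max_ideal G \<Longrightarrow> w \<in> max_ideal G \<Longrightarrow> q + u * w \<in> max_ideal_sq G"

lemma max_ideal_0 [simp, intro]: "0 \<in> max_ideal G"
  by (simp add: max_ideal_def)

lemma max_ideal_subalg: "u \<in> max_ideal G \<Longrightarrow> u \<in> subalg G"
  by (simp add: max_ideal_def)

lemma max_ideal_add [intro]: "u \<in> max_ideal G \<Longrightarrow> w \<in> max_ideal G \<Longrightarrow> u + w \<in> max_ideal G"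
  by (simp add: max_ideal_def subalg.add)

lemma max_ideal_diff [intro]: "u \<in> max_ideal G \<Longrightarrow> w \<in> max_ideal G \<Longrightarrow> u - w \<in> max_ideal G"
  by (simp add: max_ideal_def subalg_diff)

lemma max_ideal_mult [intro]: "a \<in> subalg G \<Longrightarrow> w \<in> max_ideal G \<Longrightarrow> a * w \<in> max_ideal G"
  by (simp add: max_ideal_def subalg.mult)

lemma max_ideal_sq_prod: "u \<in> max_ideal G \<Longrightarrow> w \<in> max_ideal G \<Longrightarrow> u * w \<in> max_ideal_sq G"
  using max_ideal_sq.step[OF max_ideal_sq.zero] by force

lemma max_ideal_sq_add [intro]:
  assumes "q \<in> max_ideal_sq G" "q' \<in> max_ideal_sq G"
  shows "q + q' \<in> max_ideal_sq G"
  using assms(2)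
proof (induction rule: max_ideal_sq.induct)
  case (step q' u w)
  then show ?case
    using max_ideal_sq.step[of "q + q'" G u w] by (simp add: add.assoc)
qed (use assms(1) in simp)

lemma max_ideal_sq_mult [intro]:
  assumes "a \<in> subalg G" "q \<in> max_ideal_sq G"
  shows "a * q \<in> max_ideal_sq G"
  using assms(2)
proof (induction rule: max_ideal_sq.induct)
  case (step q u w)
  then show ?case
    using max_ideal_sq.step[of "a * q" G "a * u" w] max_ideal_mult[OF assms(1)]
    by (simp add: distrib_left mult.assoc)
qed simp

lemma max_ideal_sq_sum: "(\<And>x. x \<in> I \<Longrightarrow> F x \<in> max_ideal_sq G) \<Longrightarrow> (\<Sum>x\<in>I. F x) \<in> max_ideal_sq G"
  by (induction I rule: infinite_finite_induct) auto

text \<open>Taylor expansion to first order: the classes of the \<open>C i\<close> span the maximal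
  ideal modulo its square, which therefore has dimension at most \<open>d\<close>.\<close>

lemma subalg_linear_part:
  fixes C :: "nat \<Rightarrow> 'a::field fps"
  assumes C: "\<And>i. i < d \<Longrightarrow> C i $ 0 = 0" and F: "F \<in> subalg (C ` {..<d})"
  shows "\<exists>a. F - fps_const (F $ 0) - (\<Sum>i<d. fps_const (a i) * C i) \<in> max_ideal_sq (C ` {..<d})"
  using F
proof (induction rule: subalg.induct)
  case (const a)
  show ?case by (rule exI[of _ "\<lambda>_. 0"]) simp
next
  case (gen F)
  then obtain j where j: "j < d" "F = C j" by auto
  have "(\<Sum>i<d. fps_const (if i = j then 1 else 0) * C i) = (\<Sum>i<d. if i = j then C i else 0)"
    by (rule sum.cong) auto
  also have "\<dots> = F"
    using j by simp
  finally show ?case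
    by (intro exI[of _ "\<lambda>i. if i = j then 1 else 0"]) (use j C in simp)
next
  case (add F H)
  then obtain a b where
    "F - fps_const (F $ 0) - (\<Sum>i<d. fps_const (a i) * C i) \<in> max_ideal_sq (C ` {..<d})"
    "H - fps_const (H $ 0) - (\<Sum>i<d. fps_const (b i) * C i) \<in> max_ideal_sq (C ` {..<d})"
    by blast
  from max_ideal_sq_add[OF this] show ?case
    by (intro exI[of _ "\<lambda>i. a i + b i"])
      (simp add: algebra_simps sum.distrib flip: fps_const_add)
next
  case (mult F H)
  define L where "L a = (\<Sum>i<d. fps_const (a i) * C i)" for a
  obtain a b where ab: "F - fps_const (F $ 0) - L a \<in> max_ideal_sq (C ` {..<d})"
    "H - fps_const (H $ 0) - L b \<in> max_ideal_sq (C ` {..<d})"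
    using mult.IH unfolding L_def by blast
  have "F - fps_const (F $ 0) \<in> max_ideal (C ` {..<d})" "H - fps_const (H $ 0) \<in> max_ideal (C ` {..<d})"
    using mult.hyps by (auto simp: max_ideal_def)
  then have "(F - fps_const (F $ 0)) * (H - fps_const (H $ 0)) \<in> max_ideal_sq (C ` {..<d})"
    by (rule max_ideal_sq_prod)
  \<comment> \<open>Product rule: with constant terms \<open>F0\<close> and \<open>H0\<close>,
    \<open>F * H - F0 * H0\<close> equals
    \<open>F0 * (H - H0) + H0 * (F - F0) + (F - F0) * (H - H0)\<close>, and the last summand is
    quadratic.\<close>
  with ab have "fps_const (F $ 0) * (H - fps_const (H $ 0) - L b)
      + fps_const (H $ 0) * (F - fps_const (F $ 0) - L a)
      + (F - fps_const (F $ 0)) * (H - fps_const (H $ 0)) \<in> max_ideal_sq (C ` {..<d})"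
    by blast
  moreover have "L (\<lambda>i. F $ 0 * b i + H $ 0 * a i) = fps_const (F $ 0) * L b + fps_const (H $ 0) * L a"
    by (simp add: L_def sum_distrib_left sum.distrib distrib_right mult.assoc
        flip: fps_const_add fps_const_mult)
  ultimately show ?case
    unfolding L_def[symmetric]
    by (intro exI[of _ "\<lambda>i. F $ 0 * b i + H $ 0 * a i"])
      (simp add: algebra_simps fps_const_mult[symmetric] del: fps_const_mult)
qed


section \<open>Linear relations modulo the square of the maximal ideal\<close>

text \<open>Gaussian elimination for \<open>d\<close> equations in more than \<open>d\<close>
  unknowns: a pivot \<open>p\<close> with \<open>a p d \<noteq> 0\<close> removes one unknown and
  one equation, and the induction hypothesis solves the rest.\<close>

lemma homogeneous_system_nontrivial:
  fixes a :: "'b \<Rightarrow> nat \<Rightarrow> 'a::field"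
  assumes "finite J" "d < card J"
  shows "\<exists>l. (\<exists>j\<in>J. l j \<noteq> 0) \<and> (\<forall>i<d. (\<Sum>j\<in>J. l j * a j i) = 0)"
  using assms
proof (induction d arbitrary: J a)
  case 0
  then have "J \<noteq> {}" by auto
  then show ?case by (intro exI[of _ "\<lambda>_. 1"]) auto
next
  case (Suc d)
  show ?case
  proof (cases "\<forall>j\<in>J. a j d = 0")
    case True
    obtain l where l: "\<exists>j\<in>J. l j \<noteq> 0" "\<forall>i<d. (\<Sum>j\<in>J. l j * a j i) = 0"
      using Suc.IH[OF Suc.prems(1) Suc_lessD[OF Suc.prems(2)], of a] by (elim exE conjE)
    moreover have "(\<Sum>j\<in>J. l j * a j d) = 0"
      using True by simp
    ultimately show ?thesis
      by (auto simp: less_Suc_eq)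
  next
    case False
    then obtain p where p: "p \<in> J" "a p d \<noteq> 0" by blast
    define J' where "J' = J - {p}"
    have J': "finite J'" "p \<notin> J'" "J = insert p J'" "d < card J'"
      using Suc.prems p by (auto simp: J'_def)
    obtain l where l: "\<exists>j\<in>J'. l j \<noteq> 0"
      "\<forall>i<d. (\<Sum>j\<in>J'. l j * (a j i - a j d / a p d * a p i)) = 0"
      using Suc.IH[OF J'(1,4), of "\<lambda>j i. a j i - a j d / a p d * a p i"] by (elim exE conjE)
    define s where "s = (\<Sum>j\<in>J'. l j * a j d)"
    \<comment> \<open>The pivot unknown is chosen so that equation \<open>d\<close> holds,
      \<open>s\<close> being what the other unknowns contribute to it.\<close>
    define l' where "l' = l(p := - s / a p d)"
    have eq: "(\<Sum>j\<in>J. l' j * a j i) = (\<Sum>j\<in>J'. l j * (a j i - a j d / a p d * a p i))" for i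
    proof -
      have "(\<Sum>j\<in>J'. l' j * a j i) = (\<Sum>j\<in>J'. l j * a j i)"
        using J'(2) by (intro sum.cong) (auto simp: l'_def)
      then have "(\<Sum>j\<in>J. l' j * a j i) = (\<Sum>j\<in>J'. l j * a j i) - s / a p d * a p i"
        using J'(1,2) by (simp add: J'(3) l'_def)
      also have "s / a p d * a p i = (\<Sum>j\<in>J'. l j * (a j d / a p d * a p i))"
        by (simp add: s_def sum_divide_distrib sum_distrib_right mult.assoc)
      finally show ?thesis
        by (simp add: right_diff_distrib sum_subtractf)
    qed
    have "(\<Sum>j\<in>J. l' j * a j i) = 0" if "i < Suc d" for i
      unfolding eq using that l(2) p(2) by (cases "i = d") simp_all
    moreover have "\<exists>j\<in>J. l' j \<noteq> 0"
      using l(1) J' by (auto simp: l'_def)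
    ultimately show ?thesis by blast
  qed
qed

lemma fps_const_sum: "fps_const (\<Sum>x\<in>I. c x) = (\<Sum>x\<in>I. fps_const (c x))"
  by (simp add: fps_eq_iff fps_sum_nth)

text \<open>The linear parts of the \<open>F j\<close> are coefficient vectors of length
  \<open>d\<close>; more than \<open>d\<close> of them are dependent, and a dependence leaves only
  quadratic remainders.\<close>

lemma max_ideal_relation:
  fixes C :: "nat \<Rightarrow> 'a::field fps" and F :: "'b \<Rightarrow> 'a fps" and d :: nat
  assumes C: "\<And>i. i < d \<Longrightarrow> C i $ 0 = 0"
    and J: "finite J" "d < card J" and F: "\<And>j. j \<in> J \<Longrightarrow> F j \<in> max_ideal (C ` {..<d})"
  shows "\<exists>l. (\<exists>j\<in>J. l j \<noteq> 0) \<and> (\<Sum>j\<in>J. fps_const (l j) * F j) \<in> max_ideal_sq (C ` {..<d})"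
proof -
  have "\<exists>a. F j - (\<Sum>i<d. fps_const (a i) * C i) \<in> max_ideal_sq (C ` {..<d})" if "j \<in> J" for j
    using subalg_linear_part[where C = C and d = d and F = "F j", OF C] F[OF that] by (auto simp: max_ideal_def)
  then obtain a where a: "\<And>j. j \<in> J \<Longrightarrow> F j - (\<Sum>i<d. fps_const (a j i) * C i) \<in> max_ideal_sq (C ` {..<d})"
    by metis
  obtain l where l: "\<exists>j\<in>J. l j \<noteq> 0" "\<forall>i<d. (\<Sum>j\<in>J. l j * a j i) = 0"
    using homogeneous_system_nontrivial[OF J] by blast
  have "(\<Sum>j\<in>J. fps_const (l j) * (\<Sum>i<d. fps_const (a j i) * C i))
      = (\<Sum>j\<in>J. \<Sum>i<d. fps_const (l j * a j i) * C i)"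
    by (simp add: sum_distrib_left mult.assoc flip: fps_const_mult)
  also have "\<dots> = (\<Sum>i<d. fps_const (\<Sum>j\<in>J. l j * a j i) * C i)"
    by (subst sum.swap) (simp add: sum_distrib_right fps_const_sum)
  also have "\<dots> = 0"
    using l(2) by simp
  finally have "(\<Sum>j\<in>J. fps_const (l j) * F j)
      = (\<Sum>j\<in>J. fps_const (l j) * (F j - (\<Sum>i<d. fps_const (a j i) * C i)))"
    by (simp add: right_diff_distrib sum_subtractf)
  also have "\<dots> \<in> max_ideal_sq (C ` {..<d})"
    using a by (intro max_ideal_sq_sum) auto
  finally show ?thesis
    using l(1) by blast
qed


section \<open>Reduction by an element of order \<open>m\<close> and the bound on indecomposable
  orders\<close>

text \<open>As long as the order \<open>k\<close> of the remainder is below \<open>\<mu>\<close>, it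
  is a multiple of \<open>m\<close>, so a scalar multiple of a power of \<open>f\<close> cancels the
  leading term.\<close>

lemma max_ideal_reduce:
  assumes f: "f \<in> subalg G" "f \<noteq> 0" "subdegree f = m" "m > 0"
    and mu: "\<And>s. s \<in> orders (subalg G) \<Longrightarrow> s < \<mu> \<Longrightarrow> m dvd s"
    and u: "u \<in> max_ideal G"
  shows "\<exists>a v. a \<in> subalg G \<and> v \<in> max_ideal G \<and> fps_X ^ \<mu> dvd v \<and> u = f * a + v"
proof -
  have "\<exists>a v. a \<in> subalg G \<and> v \<in> max_ideal G \<and> fps_X ^ k dvd v \<and> u = f * a + v" if "k \<le> \<mu>" for k
    using that
  proof (induction k)
    case 0
    show ?case
      by (rule exI[of _ 0], rule exI[of _ u]) (use u in simp)
  next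
    case (Suc k)
    then obtain a v where av: "a \<in> subalg G" "v \<in> max_ideal G" "fps_X ^ k dvd v" "u = f * a + v"
      by auto
    show ?case
    proof (cases "v $ k = 0")
      case True
      then have "fps_X ^ Suc k dvd v"
        using av(3) unfolding fps_X_power_dvd_iff by (auto simp: less_Suc_eq)
      with av show ?thesis by blast
    next
      case False
      then have v: "v \<noteq> 0" "subdegree v = k"
        using av(3) unfolding fps_X_power_dvd_iff by (auto intro: subdegreeI)
      then have "m dvd k"
        using mu[of k] ordersI[of v "subalg G"] av(2) Suc.prems by (auto intro: max_ideal_subalg)
      moreover have "k \<noteq> 0"
        using False av(2) by (cases k) (auto simp: max_ideal_def)
      ultimately obtain e where e: "k = m * Suc e"
        by (cases "k div m") auto
      \<comment> \<open>The cancelling term is a multiple of \<open>f ^ Suc e\<close>; one factor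
        \<open>f\<close> is split off, which is possible because \<open>k\<close> is a nonzero
        multiple of \<open>m\<close>.\<close>
      define g where "g = fps_const (v $ k / (f $ m) ^ Suc e) * f ^ e"
      have fg: "f * g = fps_const (v $ k / (f $ m) ^ Suc e) * f ^ Suc e"
        by (simp add: g_def)
      have nz: "f $ m \<noteq> 0"
        using f(2,3) by auto
      have "subdegree (f ^ Suc e) = k"
        using f(3) e by (simp del: power_Suc mult_Suc_right add: mult.commute)
      moreover have "f ^ Suc e $ k = (f $ m) ^ Suc e"
        using fps_pow_base[of f "Suc e"] f(3) e by (simp del: power_Suc mult_Suc mult_Suc_right add: mult.commute)
      ultimately have *: "(v - f * g) $ i = 0" if "i < Suc k" for i
        using that av(3) nz nth_less_subdegree_zero[of i "f ^ Suc e"]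
        unfolding fg fps_X_power_dvd_iff by (auto simp: less_Suc_eq)
      have "g \<in> subalg G"
        unfolding g_def using f(1) by blast
      moreover have "f * g \<in> max_ideal G"
        using f \<open>g \<in> subalg G\<close> by (auto simp: max_ideal_def)
      moreover have "u = f * (a + g) + (v - f * g)"
        using av(4) by (simp add: algebra_simps)
      ultimately show ?thesis
        using av(1,2) * unfolding fps_X_power_dvd_iff by blast
    qed
  qed
  then show ?thesis by blast
qed

text \<open>For \<open>u = f * a1 + v1\<close> and \<open>w = f * a2 + v2\<close> one has
  \<open>u * w = f * (a1 * w + a2 * v1) + v1 * v2\<close>. The cofactor of \<open>f\<close> stays in
  the maximal ideal because \<open>w\<close> and \<open>v1\<close> do, and \<open>v1 * v2\<close>
  vanishes to order \<open>2 * \<mu>\<close>.\<close>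

lemma max_ideal_sq_reduce:
  assumes f: "f \<in> subalg G" "f \<noteq> 0" "subdegree f = m" "m > 0"
    and mu: "\<And>s. s \<in> orders (subalg G) \<Longrightarrow> s < \<mu> \<Longrightarrow> m dvd s"
    and q: "q \<in> max_ideal_sq G"
  shows "\<exists>a b. a \<in> max_ideal G \<and> fps_X ^ (2 * \<mu>) dvd b \<and> q = f * a + b"
  using q
proof (induction rule: max_ideal_sq.induct)
  case zero
  show ?case by (rule exI[of _ 0], rule exI[of _ 0]) simp
next
  case (step q u w)
  obtain a b where ab: "a \<in> max_ideal G" "fps_X ^ (2 * \<mu>) dvd b" "q = f * a + b"
    using step.IH by blast
  obtain a1 v1 where 1: "a1 \<in> subalg G" "v1 \<in> max_ideal G" "fps_X ^ \<mu> dvd v1" "u = f * a1 + v1"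
    using max_ideal_reduce[OF f mu step.hyps(2)] by blast
  obtain a2 v2 where 2: "a2 \<in> subalg G" "v2 \<in> max_ideal G" "fps_X ^ \<mu> dvd v2" "w = f * a2 + v2"
    using max_ideal_reduce[OF f mu step.hyps(3)] by blast
  have "q + u * w = f * (a + (a1 * w + a2 * v1)) + (b + v1 * v2)"
    by (simp add: ab(3) 1(4) 2(4) algebra_simps)
  moreover have "a + (a1 * w + a2 * v1) \<in> max_ideal G"
    using ab(1) 1(1,2) 2(1) step.hyps(3) by blast
  moreover have "fps_X ^ (2 * \<mu>) dvd b + v1 * v2"
    using ab(2) fps_X_power_dvd_mult[OF 1(3) 2(3)] by (simp add: mult_2)
  ultimately show ?case by blast
qed

text \<open>Below \<open>2 * \<mu>\<close> the remainder of the reduction is invisible, so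
  \<open>q\<close> has the order of \<open>f * a\<close> with \<open>a\<close> in the maximal
  ideal.\<close>

lemma orders_max_ideal_sq:
  assumes f: "f \<in> subalg G" "f \<noteq> 0" "subdegree f = m" "m > 0"
    and mu: "\<And>s. s \<in> orders (subalg G) \<Longrightarrow> s < \<mu> \<Longrightarrow> m dvd s"
    and q: "q \<in> max_ideal_sq G" "q \<noteq> 0" "subdegree q < 2 * \<mu>"
  shows "\<exists>s \<in> orders (subalg G). s \<noteq> 0 \<and> subdegree q = m + s"
proof -
  obtain a b where ab: "a \<in> max_ideal G" "fps_X ^ (2 * \<mu>) dvd b" "q = f * a + b"
    using max_ideal_sq_reduce[OF f mu q(1)] by blast
  have "fps_X ^ (2 * \<mu>) dvd q - f * a"
    using ab by simp
  note fa = subdegree_eq_of_dvd_diff[OF this q(2,3)]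
  then have "a \<noteq> 0" by auto
  moreover have "subdegree q = m + subdegree a"
    using fa f by auto
  moreover have "subdegree a \<noteq> 0"
    using ab(1) \<open>a \<noteq> 0\<close> subdegree_eq_0_iff[of a] by (auto simp: max_ideal_def)
  ultimately show ?thesis
    using ordersI[of a "subalg G"] ab(1) by (auto intro: max_ideal_subalg)
qed

text \<open>Were \<open>J\<close> larger than \<open>d\<close>, a nontrivial combination of elements
  with orders in \<open>J\<close> would lie in the square of the maximal ideal. Its order is still
  in \<open>J\<close> and would have to split off \<open>m\<close>. This is the lower bound on the
  number of components.\<close>

lemma card_indecomposable_orders_le:
  fixes C :: "nat \<Rightarrow> 'a::field fps" and d :: nat
  defines "A \<equiv> subalg (C ` {..<d})"
  assumes C: "\<And>i. i < d \<Longrightarrow> C i $ 0 = 0"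
    and m: "m \<in> orders A" "m > 0"
    and mu: "\<And>s. s \<in> orders A \<Longrightarrow> s < \<mu> \<Longrightarrow> m dvd s"
    and J: "finite J" "J \<subseteq> orders A" "\<And>j. j \<in> J \<Longrightarrow> 0 < j \<and> j < 2 * \<mu>"
    and indec: "\<And>j s. j \<in> J \<Longrightarrow> s \<in> orders A \<Longrightarrow> s \<noteq> 0 \<Longrightarrow> j \<noteq> m + s"
  shows "card J \<le> d"
proof (rule ccontr)
  assume "\<not> card J \<le> d"
  then have card: "d < card J" by simp
  obtain f where f: "f \<in> A" "f \<noteq> 0" "subdegree f = m"
    using m(1) by (auto simp: orders_def)
  have "\<forall>j\<in>J. \<exists>F. F \<in> A \<and> F \<noteq> 0 \<and> subdegree F = j"
    using J(2) by (auto simp: orders_def)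
  from bchoice[OF this] obtain F where "\<forall>j\<in>J. F j \<in> A \<and> F j \<noteq> 0 \<and> subdegree (F j) = j"
    by (elim exE)
  note F = this[rule_format]
  have "F j \<in> max_ideal (C ` {..<d})" if "j \<in> J" for j
  proof -
    have "0 < subdegree (F j)"
      using F[OF that] J(3)[OF that] by metis
    then have "F j $ 0 = 0"
      by (rule nth_less_subdegree_zero)
    then show ?thesis
      using F[OF that] unfolding max_ideal_def A_def by blast
  qed
  then have "\<exists>l. (\<exists>j\<in>J. l j \<noteq> 0) \<and> (\<Sum>j\<in>J. fps_const (l j) * F j) \<in> max_ideal_sq (C ` {..<d})"
    by (intro max_ideal_relation C J(1) card)
  then obtain l where l: "\<exists>j\<in>J. l j \<noteq> 0" "(\<Sum>j\<in>J. fps_const (l j) * F j) \<in> max_ideal_sq (C ` {..<d})"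
    by (elim exE conjE)
  obtain j where j: "j \<in> J" "l j \<noteq> 0"
    using l(1) by (elim bexE)
  define q where "q = (\<Sum>j\<in>J. fps_const (l j) * F j)"
  have q: "q \<noteq> 0" "subdegree q \<in> J"
    unfolding q_def using subdegree_combination[of J F j l, OF J(1) F[THEN conjunct2] j] by simp_all
  have "\<exists>s\<in>orders A. s \<noteq> 0 \<and> subdegree q = m + s"
    unfolding A_def
    by (rule orders_max_ideal_sq[where f = f and q = q and \<mu> = \<mu>])
      (use f m(2) mu l(2) q(1) J(3)[OF q(2)] in \<open>simp_all add: A_def q_def\<close>)
  with indec[OF q(2)] show False by blast
qed


section \<open>The semigroup of a curve\<close>

definition fps_monomial :: "nat \<Rightarrow> (nat \<Rightarrow> 'a::field fps) \<Rightarrow> (nat \<Rightarrow> nat) \<Rightarrow> 'a fps" where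
  "fps_monomial d C \<alpha> = (\<Prod>i<d. C i ^ \<alpha> i)"

text \<open>Polynomials in the \<open>C i\<close> as explicit combinations of monomials, the form in
  which they can be read as finitely supported coefficient families for
  \<open>mps_eval\<close>.\<close>

inductive_set monomial_span :: "nat \<Rightarrow> (nat \<Rightarrow> 'a::field fps) \<Rightarrow> 'a fps set" for d C where
  zero: "0 \<in> monomial_span d C"
| step: "F \<in> monomial_span d C \<Longrightarrow> F + fps_const a * fps_monomial d C \<alpha> \<in> monomial_span d C"

lemma monomial_span_add:
  assumes "F \<in> monomial_span d C" "H \<in> monomial_span d C"
  shows "F + H \<in> monomial_span d C"
  using assms(2)
proof (induction rule: monomial_span.induct)
  case (step H a \<alpha>)
  then show ?case
    using monomial_span.step[of "F + H" d C a \<alpha>] by (simp add: add.assoc)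
qed (use assms(1) in simp)

lemma monomial_span_mult_monomial:
  assumes "F \<in> monomial_span d C"
  shows "F * (fps_const b * fps_monomial d C \<beta>) \<in> monomial_span d C"
  using assms
proof (induction rule: monomial_span.induct)
  case zero
  then show ?case by (simp add: monomial_span.zero)
next
  case (step F a \<alpha>)
  have *: "fps_monomial d C \<alpha> * fps_monomial d C \<beta> = fps_monomial d C (\<lambda>i. \<alpha> i + \<beta> i)"
    by (simp add: fps_monomial_def power_add prod.distrib)
  have "(F + fps_const a * fps_monomial d C \<alpha>) * (fps_const b * fps_monomial d C \<beta>)
      = F * (fps_const b * fps_monomial d C \<beta>) + fps_const (a * b) * fps_monomial d C (\<lambda>i. \<alpha> i + \<beta> i)"
    unfolding *[symmetric] fps_const_mult[symmetric] by (simp add: algebra_simps del: fps_const_mult)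
  then show ?case
    using monomial_span.step[OF step.IH, of "a * b" "\<lambda>i. \<alpha> i + \<beta> i"] by simp
qed

lemma monomial_span_mult:
  assumes "F \<in> monomial_span d C" "H \<in> monomial_span d C"
  shows "F * H \<in> monomial_span d C"
  using assms(2)
proof (induction rule: monomial_span.induct)
  case zero
  then show ?case by (simp add: monomial_span.zero)
next
  case (step H a \<alpha>)
  then show ?case
    using monomial_span_add[OF step.IH monomial_span_mult_monomial[OF assms(1), of a \<alpha>]]
    by (simp add: distrib_left)
qed

lemma subalg_subset_monomial_span: "subalg (C ` {..<d}) \<subseteq> monomial_span d C"
proof
  have single: "fps_const a * fps_monomial d C \<alpha> \<in> monomial_span d C" for a \<alpha>
    using monomial_span.step[OF monomial_span.zero, of a d C \<alpha>] by simp
  fix F assume "F \<in> subalg (C ` {..<d})"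
  then show "F \<in> monomial_span d C"
  proof (induction rule: subalg.induct)
    case (const a)
    show ?case
      using single[of a "\<lambda>_. 0"] by (simp add: fps_monomial_def)
  next
    case (gen F)
    then obtain j where j: "j < d" "F = C j" by auto
    have "fps_monomial d C (\<lambda>i. if i = j then 1 else 0) = (\<Prod>i<d. if i = j then C i else 1)"
      unfolding fps_monomial_def by (rule prod.cong) auto
    also have "\<dots> = F"
      using j by simp
    finally show ?case
      using single[of 1 "\<lambda>i. if i = j then 1 else 0"] by simp
  qed (simp_all add: monomial_span_add monomial_span_mult)
qed

section \<open>From convergent power series to polynomials and back\<close>

text \<open>If the order \<open>k\<close> were below \<open>n\<close>, then
  \<open>f t / t ^ k\<close> would tend both to the leading coefficient and, by the bound, to
  0.\<close>

lemma has_fps_expansion_low_order: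
  fixes f :: "complex \<Rightarrow> complex"
  assumes F: "f has_fps_expansion F"
    and bound: "\<forall>\<^sub>F t in nhds 0. norm (f t) \<le> K * norm t ^ n"
  shows "fps_X ^ n dvd F"
proof (cases "F = 0")
  case False
  define k where "k = subdegree F"
  have "n \<le> k"
  proof (rule ccontr)
    assume "\<not> n \<le> k"
    then have k: "k < n" by simp
    define g where "g = (\<lambda>t. if t = 0 then F $ k else f t / t ^ k)"
    have "g has_fps_expansion fps_shift k F"
      unfolding g_def by (rule has_fps_expansion_shift[OF F]) (simp_all add: k_def)
    then have lim: "(g \<longlongrightarrow> F $ k) (at 0)"
      using has_fps_expansion_imp_continuous[of g "fps_shift k F" UNIV]
      by (simp add: continuous_within g_def)
    have "\<forall>\<^sub>F t in at 0. norm (g t) \<le> K * norm t ^ (n - k)"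
    proof -
      have "\<forall>\<^sub>F t in at 0. norm (f t) \<le> K * norm t ^ n"
        using bound by (simp add: eventually_nhds_conv_at)
      moreover have "\<forall>\<^sub>F t in at (0::complex). t \<noteq> 0"
        by (simp add: eventually_at_filter)
      ultimately show ?thesis
      proof eventually_elim
        case (elim t)
        then show ?case
          using k by (simp add: g_def norm_divide norm_power power_diff field_simps)
      qed
    qed
    moreover have "((\<lambda>t::complex. K * norm t ^ (n - k)) \<longlongrightarrow> K * norm (0::complex) ^ (n - k)) (at 0)"
      by (intro tendsto_intros)
    then have "((\<lambda>t::complex. K * norm t ^ (n - k)) \<longlongrightarrow> 0) (at 0)"
      using k by (simp add: power_0_left)
    ultimately have "(g \<longlongrightarrow> 0) (at 0)"
      by (rule Lim_null_comparison)
    then have "F $ k = 0"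
      using lim tendsto_unique[of "at (0::complex)" g] by simp
    with False show False
      by (simp add: k_def)
  qed
  then show ?thesis
    using fps_dvd_iff[of "fps_X ^ n" F] False by (simp add: k_def)
qed simp

text \<open>Termwise comparison with the point all of whose coordinates are \<open>\<rho>\<close>: a
  monomial of degree at least \<open>n\<close> shrinks by at least \<open>(L / \<rho>) ^ n\<close>,
  since \<open>L / \<rho> \<le> 1\<close>.\<close>

lemma norm_infsum_high_degree_le:
  fixes p :: "(nat \<Rightarrow> nat) \<Rightarrow> complex"
  assumes summable: "(\<lambda>\<alpha>. mps_term d p (\<lambda>_. of_real \<rho>) \<alpha>) summable_on multi_indices d"
    and \<rho>: "\<rho> > 0" and A: "A \<subseteq> multi_indices d" "\<And>\<alpha>. \<alpha> \<in> A \<Longrightarrow> n \<le> (\<Sum>i<d. \<alpha> i)"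
    and x: "\<And>i. i < d \<Longrightarrow> norm (x i) \<le> L" and L: "0 \<le> L" "L \<le> \<rho>"
  shows "norm (\<Sum>\<^sub>\<infinity>\<alpha>\<in>A. mps_term d p x \<alpha>)
    \<le> (\<Sum>\<^sub>\<infinity>\<alpha>\<in>A. norm (mps_term d p (\<lambda>_. of_real \<rho>) \<alpha>)) * (L / \<rho>) ^ n"
proof -
  have le: "norm (mps_term d p x \<alpha>) \<le> norm (mps_term d p (\<lambda>_. of_real \<rho>) \<alpha>) * (L / \<rho>) ^ n"
    if "\<alpha> \<in> A" for \<alpha>
  proof -
    define s where "s = (\<Sum>i<d. \<alpha> i)"
    have "norm (\<Prod>i<d. x i ^ \<alpha> i) \<le> (\<Prod>i<d. L ^ \<alpha> i)"
      unfolding prod_norm[symmetric] by (rule prod_mono) (auto simp: norm_power intro!: power_mono x)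
    also have "\<dots> = L ^ s"
      by (simp add: s_def power_sum)
    also have "\<dots> = \<rho> ^ s * (L / \<rho>) ^ s"
      using \<rho> by (simp flip: power_mult_distrib)
    also have "\<dots> \<le> \<rho> ^ s * (L / \<rho>) ^ n"
      using \<rho> L A(2)[OF that] by (intro mult_left_mono power_decreasing) (auto simp: s_def)
    finally have "norm (p \<alpha>) * norm (\<Prod>i<d. x i ^ \<alpha> i) \<le> norm (p \<alpha>) * (\<rho> ^ s * (L / \<rho>) ^ n)"
      by (rule mult_left_mono) simp
    moreover have "norm (\<Prod>i<d. complex_of_real \<rho> ^ \<alpha> i) = \<rho> ^ s"
      using \<rho> by (simp add: s_def power_sum norm_power flip: prod_norm)
    ultimately show ?thesis
      by (simp add: mps_term_def norm_mult mult.assoc)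
  qed
  have "(\<lambda>\<alpha>. norm (mps_term d p (\<lambda>_. of_real \<rho>) \<alpha>)) summable_on A"
    using summable A(1) summable_on_iff_abs_summable_on_complex summable_on_subset_banach by blast
  then have s: "(\<lambda>\<alpha>. norm (mps_term d p (\<lambda>_. of_real \<rho>) \<alpha>) * (L / \<rho>) ^ n) summable_on A"
    by (rule summable_on_cmult_left)
  then have s': "(\<lambda>\<alpha>. norm (mps_term d p x \<alpha>)) summable_on A"
    using le by (rule Infinite_Sum.abs_summable_on_comparison_test')
  have "norm (\<Sum>\<^sub>\<infinity>\<alpha>\<in>A. mps_term d p x \<alpha>) \<le> (\<Sum>\<^sub>\<infinity>\<alpha>\<in>A. norm (mps_term d p x \<alpha>))"
    using s' by (rule norm_infsum_bound)
  also have "\<dots> \<le> (\<Sum>\<^sub>\<infinity>\<alpha>\<in>A. norm (mps_term d p (\<lambda>_. of_real \<rho>) \<alpha>) * (L / \<rho>) ^ n)"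
    using s' s le by (rule infsum_mono)
  finally show ?thesis
    by (simp add: infsum_cmult_left')
qed

lemma finite_multi_indices_le: "finite {\<alpha> \<in> multi_indices d. (\<Sum>i<d. \<alpha> i) \<le> n}"
proof (rule finite_subset)
  show "{\<alpha> \<in> multi_indices d. (\<Sum>i<d. \<alpha> i) \<le> n} \<subseteq> {..<d} \<rightarrow>\<^sub>E {..n}"
  proof
    fix \<alpha> assume \<alpha>: "\<alpha> \<in> {\<alpha> \<in> multi_indices d. (\<Sum>i<d. \<alpha> i) \<le> n}"
    have "\<alpha> i \<le> n" if "i < d" for i
      using \<alpha> member_le_sum[of i "{..<d}" \<alpha>] that by auto
    with \<alpha> show "\<alpha> \<in> {..<d} \<rightarrow>\<^sub>E {..n}"
      by (auto simp: multi_indices_def PiE_iff)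
  qed
qed (auto intro: finite_PiE)

text \<open>Cut \<open>p\<close> off above total degree \<open>n\<close>. The components of the
  curve are bounded by a multiple of \<open>norm t\<close> near 0, so the tail is bounded by a
  multiple of \<open>norm t ^ Suc n\<close> and cannot affect the coefficients up to degree
  \<open>n\<close>.\<close>

lemma mps_eval_polynomial_approximation:
  assumes C: "\<And>i. i < d \<Longrightarrow> c i has_fps_expansion C i" "\<And>i. i < d \<Longrightarrow> C i $ 0 = 0"
    and p: "mps_convergent d p" and F: "(\<lambda>t. mps_eval d p (\<lambda>i. c i t)) has_fps_expansion F"
  shows "\<exists>G \<in> subalg (C ` {..<d}). fps_X ^ Suc n dvd F - G"
proof -
  define T where "T = {\<alpha> \<in> multi_indices d. (\<Sum>i<d. \<alpha> i) \<le> n}"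
  define A where "A = multi_indices d - T"
  define G where "G = (\<Sum>\<alpha>\<in>T. fps_const (p \<alpha>) * fps_monomial d C \<alpha>)"
  have T: "finite T" "T \<subseteq> multi_indices d"
    using finite_multi_indices_le[of d n] by (auto simp: T_def)
  have "G \<in> subalg (C ` {..<d})"
    unfolding G_def fps_monomial_def
    by (intro subalg_sum subalg.mult subalg_prod subalg_power subalg.const subalg.gen) auto
  have exp_G: "(\<lambda>t. \<Sum>\<alpha>\<in>T. mps_term d p (\<lambda>i. c i t) \<alpha>) has_fps_expansion G"
    unfolding G_def fps_monomial_def mps_term_def
    by (intro has_fps_expansion_sum has_fps_expansion_mult has_fps_expansion_const
        has_fps_expansion_prod has_fps_expansion_power C) auto
  obtain r where r: "r > 0"
    "\<And>x. (\<forall>i<d. norm (x i) < r) \<Longrightarrow> mps_term d p x summable_on multi_indices d"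
    using p unfolding mps_convergent_def by blast
  define \<rho> where "\<rho> = r / 2"
  have \<rho>: "\<rho> > 0" "\<rho> < r"
    using r(1) by (auto simp: \<rho>_def)
  have "\<exists>K. \<forall>\<^sub>F t in nhds 0. norm (c i t) \<le> K * norm t" if "i < d" for i
  proof (cases "C i = 0")
    case True
    then have "\<forall>\<^sub>F t in nhds 0. c i t = 0"
      using C(1)[OF that] by (simp add: has_fps_expansion_0_iff)
    then show ?thesis
      by (intro exI[of _ 0]) (simp add: eventually_mono)
  next
    case False
    then have sd: "1 \<le> subdegree (C i)"
      using C(2)[OF that] by (simp add: Suc_le_eq subdegree_eq_0_iff flip: neq0_conv)
    define g where "g = (\<lambda>t. if t = 0 then C i $ 1 else c i t / t ^ 1)"
    have "g has_fps_expansion fps_shift 1 (C i)"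
      unfolding g_def
      by (rule has_fps_expansion_shift[OF C(1)[OF that] sd]) simp
    then have "(g \<longlongrightarrow> g 0) (nhds 0)"
      using has_fps_expansion_imp_continuous[of g _ UNIV]
      by (simp add: continuous_within tendsto_at_iff_tendsto_nhds)
    then have "((\<lambda>t. norm (g t)) \<longlongrightarrow> norm (g 0)) (nhds 0)"
      by (rule tendsto_norm)
    then have "\<forall>\<^sub>F t in nhds 0. norm (g t) < norm (g 0) + 1"
      by (rule order_tendstoD) simp
    moreover have "\<forall>\<^sub>F t in nhds 0. norm (g t) < norm (g 0) + 1 \<longrightarrow> norm (c i t) \<le> (norm (g 0) + 1) * norm t"
    proof (intro always_eventually allI impI)
      fix t assume t: "norm (g t) < norm (g 0) + 1"
      have "c i 0 = 0"
        using has_fps_expansion_imp_0_eq_fps_nth_0[OF C(1)[OF that]] C(2)[OF that] by simp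
      then have "c i t = g t * t"
        by (simp add: g_def)
      then show "norm (c i t) \<le> (norm (g 0) + 1) * norm t"
        using t by (simp add: norm_mult mult_right_mono)
    qed
    ultimately have "\<forall>\<^sub>F t in nhds 0. norm (c i t) \<le> (norm (g 0) + 1) * norm t"
      by (rule eventually_mp[rotated])
    then show ?thesis
      by (rule exI)
  qed
  then obtain K where K: "\<And>i. i < d \<Longrightarrow> \<forall>\<^sub>F t in nhds 0. norm (c i t) \<le> K i * norm t"
    by metis
  \<comment> \<open>A common bound for the finitely many constants \<open>K i\<close>; the summand 1
    makes it positive even if all of them vanish.\<close>
  define L where "L = (\<Sum>i<d. \<bar>K i\<bar>) + 1"
  have L: "L > 0"
    unfolding L_def by (intro add_nonneg_pos sum_nonneg) auto
  have KL: "K i \<le> L" if "i < d" for i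
    using member_le_sum[of i "{..<d}" "\<lambda>i. \<bar>K i\<bar>"] that unfolding L_def by force
  have "\<forall>\<^sub>F t in nhds 0. \<forall>i\<in>{..<d}. norm (c i t) \<le> K i * norm t"
    using K by (intro eventually_ball_finite) auto
  moreover have "\<forall>\<^sub>F t in nhds (0::complex). L * norm t < \<rho>"
  proof -
    have "((\<lambda>t::complex. L * norm t) \<longlongrightarrow> L * norm (0::complex)) (nhds 0)"
      by (intro tendsto_intros filterlim_ident)
    then show ?thesis
      by (rule order_tendstoD) (use \<rho> in simp)
  qed
  ultimately have "\<forall>\<^sub>F t in nhds 0. norm (mps_eval d p (\<lambda>i. c i t) - (\<Sum>\<alpha>\<in>T. mps_term d p (\<lambda>i. c i t) \<alpha>))
    \<le> ((\<Sum>\<^sub>\<infinity>\<alpha>\<in>A. norm (mps_term d p (\<lambda>_. of_real \<rho>) \<alpha>)) * (L / \<rho>) ^ Suc n) * norm t ^ Suc n"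
  proof eventually_elim
    case (elim t)
    have x: "norm (c i t) \<le> L * norm t" if "i < d" for i
      using elim(1) mult_right_mono[OF KL[OF that], of "norm t"] that by force
    have sm: "mps_term d p (\<lambda>i. c i t) summable_on multi_indices d"
      using x elim(2) \<rho> by (intro r(2)) force
    then have "mps_term d p (\<lambda>i. c i t) summable_on A"
      by (rule summable_on_subset_banach) (auto simp: A_def)
    moreover have "T \<union> A = multi_indices d" "T \<inter> A = {}"
      using T by (auto simp: A_def)
    ultimately have "mps_eval d p (\<lambda>i. c i t) - (\<Sum>\<alpha>\<in>T. mps_term d p (\<lambda>i. c i t) \<alpha>)
        = (\<Sum>\<^sub>\<infinity>\<alpha>\<in>A. mps_term d p (\<lambda>i. c i t) \<alpha>)"
      using infsum_Un_disjoint[of "mps_term d p (\<lambda>i. c i t)" T A] T(1) by (simp add: mps_eval_def)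
    moreover have "norm (\<Sum>\<^sub>\<infinity>\<alpha>\<in>A. mps_term d p (\<lambda>i. c i t) \<alpha>)
        \<le> (\<Sum>\<^sub>\<infinity>\<alpha>\<in>A. norm (mps_term d p (\<lambda>_. of_real \<rho>) \<alpha>)) * (L * norm t / \<rho>) ^ Suc n"
      using x elim(2) \<rho> L
      by (intro norm_infsum_high_degree_le r(2)) (auto simp: A_def T_def simp del: power_Suc)
    ultimately show ?case
      by (simp add: power_mult_distrib power_divide field_simps del: power_Suc)
  qed
  then have "fps_X ^ Suc n dvd F - G"
    by (rule has_fps_expansion_low_order[OF has_fps_expansion_diff[OF F exp_G]])
  with \<open>G \<in> subalg (C ` {..<d})\<close> show ?thesis by blast
qed

lemma mps_term_summable_polynomial:
  assumes "finite {\<alpha>. p \<alpha> \<noteq> 0}"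
  shows "mps_term d p x summable_on multi_indices d"
proof -
  have "mps_term d p x summable_on {\<alpha> \<in> multi_indices d. p \<alpha> \<noteq> 0}"
    by (rule summable_on_finite) (rule finite_subset[OF _ assms], auto)
  then show ?thesis
    by (rule summable_on_cong_neutral[THEN iffD1, rotated -1]) (auto simp: mps_term_def)
qed

lemma mps_convergent_polynomial:
  assumes "finite {\<alpha>. p \<alpha> \<noteq> 0}"
  shows "mps_convergent d p"
  unfolding mps_convergent_def
  using mps_term_summable_polynomial[OF assms] zero_less_one by blast

lemma monomial_span_mps_eval:
  assumes C: "\<And>i. i < d \<Longrightarrow> c i has_fps_expansion C i" and F: "F \<in> monomial_span d C"
  shows "\<exists>p. finite {\<alpha>. p \<alpha> \<noteq> 0} \<and> (\<lambda>t. mps_eval d p (\<lambda>i. c i t)) has_fps_expansion F"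
  using F
proof (induction rule: monomial_span.induct)
  case zero
  show ?case
    by (rule exI[of _ "\<lambda>_. 0"]) (simp add: mps_eval_def mps_term_def)
next
  case (step F a \<alpha>)
  then obtain p where p: "finite {\<alpha>. p \<alpha> \<noteq> 0}" "(\<lambda>t. mps_eval d p (\<lambda>i. c i t)) has_fps_expansion F"
    by blast
  \<comment> \<open>\<open>multi_indices\<close> contains only extensional functions, so the
    exponent is restricted first; \<open>e\<close> is the coefficient family of the single monomial
    \<open>\<beta>\<close>.\<close>
  define \<beta> where "\<beta> = restrict \<alpha> {..<d}"
  define e where "e = (\<lambda>\<gamma>. if \<gamma> = \<beta> then a else 0)"
  have "\<beta> \<in> multi_indices d"
    by (simp add: \<beta>_def multi_indices_def)
  have fin: "finite {\<alpha>. e \<alpha> \<noteq> 0}"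
    by (rule finite_subset[of _ "{\<beta>}"]) (auto simp: e_def)
  have "mps_eval d e x = a * (\<Prod>i<d. x i ^ \<alpha> i)" for x
  proof -
    have "mps_eval d e x = (\<Sum>\<^sub>\<infinity>\<gamma>\<in>{\<beta>}. mps_term d e x \<gamma>)"
      unfolding mps_eval_def using \<open>\<beta> \<in> multi_indices d\<close>
      by (intro infsum_cong_neutral) (auto simp: mps_term_def e_def)
    then show ?thesis
      by (simp add: mps_term_def e_def \<beta>_def)
  qed
  moreover have "mps_eval d (\<lambda>\<gamma>. p \<gamma> + e \<gamma>) x = mps_eval d p x + mps_eval d e x" for x
  proof -
    have "mps_term d (\<lambda>\<gamma>. p \<gamma> + e \<gamma>) x = (\<lambda>\<gamma>. mps_term d p x \<gamma> + mps_term d e x \<gamma>)"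
      by (simp add: fun_eq_iff mps_term_def distrib_right)
    then show ?thesis
      using infsum_add[OF mps_term_summable_polynomial[OF p(1)] mps_term_summable_polynomial[OF fin]]
      by (simp add: mps_eval_def)
  qed
  ultimately have "(\<lambda>t. mps_eval d (\<lambda>\<gamma>. p \<gamma> + e \<gamma>) (\<lambda>i. c i t))
      = (\<lambda>t. mps_eval d p (\<lambda>i. c i t) + a * (\<Prod>i<d. c i t ^ \<alpha> i))"
    by simp
  moreover have "\<dots> has_fps_expansion F + fps_const a * fps_monomial d C \<alpha>"
    unfolding fps_monomial_def
    by (intro has_fps_expansion_add p has_fps_expansion_mult has_fps_expansion_const
        has_fps_expansion_prod has_fps_expansion_power C) auto
  moreover have "finite {\<gamma>. p \<gamma> + e \<gamma> \<noteq> 0}"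
    by (rule finite_subset[OF _ finite_UnI[OF p(1) fin]]) auto
  ultimately show ?case
    by (intro exI[of _ "\<lambda>\<gamma>. p \<gamma> + e \<gamma>"]) simp
qed

text \<open>The passage from analysis to algebra: approximation one degree beyond the order turns a
  convergent series into a polynomial of the same order, and conversely polynomials converge
  everywhere.\<close>

lemma curve_semigroup_eq_orders:
  assumes C: "\<And>i. i < d \<Longrightarrow> c i has_fps_expansion C i" "\<And>i. i < d \<Longrightarrow> C i $ 0 = 0"
  shows "curve_semigroup d c = orders (subalg (C ` {..<d}))"
proof (intro equalityI subsetI)
  fix n assume "n \<in> curve_semigroup d c"
  then obtain p F where F: "mps_convergent d p" "F \<noteq> 0" "n = subdegree F"
    "(\<lambda>t. mps_eval d p (\<lambda>i. c i t)) has_fps_expansion F"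
    unfolding curve_semigroup_def by blast
  obtain G where G: "G \<in> subalg (C ` {..<d})" "fps_X ^ Suc n dvd F - G"
    using mps_eval_polynomial_approximation[OF C F(1,4)] by blast
  have "G \<noteq> 0" "subdegree G = n"
    using subdegree_eq_of_dvd_diff[OF G(2) F(2)] F(3) by simp_all
  then show "n \<in> orders (subalg (C ` {..<d}))"
    using ordersI[OF G(1)] by simp
next
  fix n assume "n \<in> orders (subalg (C ` {..<d}))"
  then obtain F where F: "F \<in> subalg (C ` {..<d})" "F \<noteq> 0" "n = subdegree F"
    by (auto simp: orders_def)
  have "F \<in> monomial_span d C"
    using F(1) subalg_subset_monomial_span by (rule rev_subsetD)
  with C(1) have "\<exists>p. finite {\<alpha>. p \<alpha> \<noteq> 0} \<and> (\<lambda>t. mps_eval d p (\<lambda>i. c i t)) has_fps_expansion F"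
    by (rule monomial_span_mps_eval)
  then obtain p where p: "finite {\<alpha>. p \<alpha> \<noteq> 0}"
    "(\<lambda>t. mps_eval d p (\<lambda>i. c i t)) has_fps_expansion F"
    by (elim exE conjE)
  show "n \<in> curve_semigroup d c"
    unfolding curve_semigroup_def mem_Collect_eq
    by (intro exI[of _ p] exI[of _ F] conjI F p mps_convergent_polynomial)
qed

section \<open>Subalgebras generated by two power series\<close>

lemma subdegree_pos_imp:
  assumes "0 < subdegree F"
  shows "F $ 0 = 0" "F \<noteq> 0"
proof -
  show "F $ 0 = 0"
    using assms by (rule nth_less_subdegree_zero)
  show "F \<noteq> 0"
    using assms by (rule contrapos_pn) simp
qed

text \<open>The three elements \<open>f\<close>, \<open>g\<close>, \<open>u\<close> are dependent
  modulo the square, where the dimension is at most two; independence of \<open>f\<close> and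
  \<open>g\<close> makes the coefficient of \<open>u\<close> nonzero.\<close>

lemma span_mod_max_ideal_sq:
  fixes C :: "nat \<Rightarrow> 'a::field fps"
  assumes C: "\<And>i. i < 2 \<Longrightarrow> C i $ 0 = 0"
    and fg: "f \<in> max_ideal (C ` {..<2})" "g \<in> max_ideal (C ` {..<2})"
    and indep: "\<And>a b. a \<noteq> 0 \<or> b \<noteq> 0 \<Longrightarrow> fps_const a * f + fps_const b * g \<notin> max_ideal_sq (C ` {..<2})"
    and u: "u \<in> max_ideal (C ` {..<2})"
  shows "\<exists>a b. u - fps_const a * f - fps_const b * g \<in> max_ideal_sq (C ` {..<2})"
proof -
  define F where "F = (\<lambda>j::nat. if j = 0 then f else if j = 1 then g else u)"
  have "\<exists>l. (\<exists>j\<in>{0,1,2}. l j \<noteq> 0) \<and> (\<Sum>j\<in>{0,1,2}. fps_const (l j) * F j) \<in> max_ideal_sq (C ` {..<2})"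
    using fg u by (intro max_ideal_relation C) (auto simp: F_def)
  then obtain l where l': "\<exists>j\<in>{0,1,2}. l j \<noteq> 0"
    "(\<Sum>j\<in>{0,1,2}. fps_const (l j) * F j) \<in> max_ideal_sq (C ` {..<2})"
    by (elim exE conjE)
  have l: "l 0 \<noteq> 0 \<or> l 1 \<noteq> 0 \<or> l 2 \<noteq> 0"
    "fps_const (l 0) * f + (fps_const (l 1) * g + fps_const (l 2) * u) \<in> max_ideal_sq (C ` {..<2})"
    using l' by (simp_all add: F_def)
  have "l 2 \<noteq> 0"
    using l indep[of "l 0" "l 1"] by auto
  then have one: "fps_const (1 / l 2) * fps_const (l 2) = 1"
    by simp
  have "fps_const (1 / l 2) * (fps_const (l 0) * f + (fps_const (l 1) * g + fps_const (l 2) * u))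
      \<in> max_ideal_sq (C ` {..<2})"
    using l(2) by (rule max_ideal_sq_mult[OF subalg.const])
  also have "fps_const (1 / l 2) * (fps_const (l 0) * f + (fps_const (l 1) * g + fps_const (l 2) * u))
      = fps_const (1 / l 2) * fps_const (l 2) * u
        + fps_const (1 / l 2) * fps_const (l 0) * f + fps_const (1 / l 2) * fps_const (l 1) * g"
    by (simp only: distrib_left mult.assoc add_ac)
  also have "\<dots> = u - fps_const (- l 0 / l 2) * f - fps_const (- l 1 / l 2) * g"
    unfolding one by (simp add: fps_const_neg[symmetric] del: fps_const_neg)
  finally show ?thesis
    by blast
qed

text \<open>Successive approximation in the style of Nakayama. Modulo constants and the span of
  \<open>f\<close> and \<open>g\<close>, only products of two elements without constant term remain,
  and approximating both factors to order \<open>N\<close> approximates the product to order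
  \<open>N + 1\<close>.\<close>

lemma subalg_two_dense:
  fixes f g :: "'a::field fps"
  assumes fg: "f $ 0 = 0" "g $ 0 = 0"
    and span: "\<And>u. u \<in> max_ideal G \<Longrightarrow> \<exists>a b. u - fps_const a * f - fps_const b * g \<in> max_ideal_sq G"
    and u: "u \<in> subalg G"
  shows "\<exists>w \<in> subalg {f, g}. fps_X ^ N dvd u - w"
  using u
proof (induction N arbitrary: u)
  case 0
  show ?case by (rule bexI[of _ 0]) simp_all
next
  case (Suc N)
  show ?case
  proof (cases "N = 0")
    case True
    then show ?thesis
      by (intro bexI[of _ "fps_const (u $ 0)"]) (simp_all add: fps_X_dvd_iff)
  next
    case False
    have max_ideal_sq: "\<exists>w \<in> subalg {f, g}. fps_X ^ Suc N dvd q - w" if "q \<in> max_ideal_sq G" for q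
      using that
    proof (induction rule: max_ideal_sq.induct)
      case zero
      show ?case by (rule bexI[of _ 0]) simp_all
    next
      case (step q u1 u2)
      obtain w where w: "w \<in> subalg {f, g}" "fps_X ^ Suc N dvd q - w"
        using step.IH by blast
      obtain w1 where w1: "w1 \<in> subalg {f, g}" "fps_X ^ N dvd u1 - w1"
        using Suc.IH[OF max_ideal_subalg[OF step.hyps(2)]] by blast
      obtain w2 where w2: "w2 \<in> subalg {f, g}" "fps_X ^ N dvd u2 - w2"
        using Suc.IH[OF max_ideal_subalg[OF step.hyps(3)]] by blast
      \<comment> \<open>Here \<open>N > 0\<close> enters: the approximation \<open>w2\<close>
        inherits the vanishing constant term of \<open>u2\<close>, which supplies the extra factor
        \<open>fps_X\<close>.\<close>
      have "(u2 - w2) $ 0 = 0"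
        using w2(2) False unfolding fps_X_power_dvd_iff by blast
      then have X: "fps_X ^ 1 dvd u1" "fps_X ^ 1 dvd w2"
        using step.hyps by (simp_all add: fps_X_dvd_iff max_ideal_def)
      have "fps_X ^ (N + 1) dvd (u1 - w1) * w2" "fps_X ^ (N + 1) dvd (u2 - w2) * u1"
        by (rule fps_X_power_dvd_mult[OF w1(2) X(2)], rule fps_X_power_dvd_mult[OF w2(2) X(1)])
      then have "fps_X ^ Suc N dvd (q - w) + ((u1 - w1) * w2 + (u2 - w2) * u1)"
        using w(2) by (simp only: Suc_eq_plus1 dvd_add)
      also have "(q - w) + ((u1 - w1) * w2 + (u2 - w2) * u1) = q + u1 * u2 - (w + w1 * w2)"
        by (simp add: algebra_simps)
      finally show ?case
        using w(1) w1(1) w2(1) by blast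
    qed
    have "u - fps_const (u $ 0) \<in> max_ideal G"
      using Suc.prems by (auto simp: max_ideal_def)
    then obtain a b where ab: "u - fps_const (u $ 0) - fps_const a * f - fps_const b * g \<in> max_ideal_sq G"
      using span by blast
    then obtain w where w: "w \<in> subalg {f, g}"
      "fps_X ^ Suc N dvd u - fps_const (u $ 0) - fps_const a * f - fps_const b * g - w"
      using max_ideal_sq by blast
    then have "fps_X ^ Suc N dvd u - (fps_const (u $ 0) + fps_const a * f + fps_const b * g + w)"
      by (simp only: diff_diff_eq add.assoc)
    moreover have "fps_const (u $ 0) + fps_const a * f + fps_const b * g + w \<in> subalg {f, g}"
      using w(1) by (intro subalg.add subalg.mult subalg.const) (auto intro: subalg.gen)
    ultimately show ?thesis by blast
  qed
qed

section \<open>The module generated by 1 and \<open>g\<close> over power series in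
  \<open>f\<close>\<close>

text \<open>The module \<open>K[[f]] + K[[f]] g\<close>. The name refers to the case where
  \<open>f\<close> has order 4 and \<open>g\<close> has order 2 modulo 4, when all nonzero elements
  have even order.\<close>

definition even_part :: "'a::field fps \<Rightarrow> 'a fps \<Rightarrow> 'a fps set" where
  "even_part f g = {(p oo f) + (q oo f) * g | p q. True}"

lemma even_partI: "(p oo f) + (q oo f) * g \<in> even_part f g"
  by (auto simp: even_part_def)

lemma even_part_add:
  assumes "u \<in> even_part f g" "w \<in> even_part f g"
  shows "u + w \<in> even_part f g"
proof -
  obtain p q p' q' where "u = (p oo f) + (q oo f) * g" "w = (p' oo f) + (q' oo f) * g"
    using assms by (auto simp: even_part_def)
  then have "u + w = ((p + p') oo f) + ((q + q') oo f) * g"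
    by (simp add: fps_compose_add_distrib algebra_simps)
  then show ?thesis
    by (simp only: even_partI)
qed

lemma even_part_mult_compose:
  assumes "f $ 0 = 0" "w \<in> even_part f g"
  shows "(r oo f) * w \<in> even_part f g"
proof -
  obtain p q where "w = (p oo f) + (q oo f) * g"
    using assms by (auto simp: even_part_def)
  then have "(r oo f) * w = ((r * p) oo f) + ((r * q) oo f) * g"
    by (simp add: fps_compose_mult_distrib[OF assms(1)] algebra_simps)
  then show ?thesis
    by (simp only: even_partI)
qed

lemma even_part_compose: "(p oo f) \<in> even_part f g"
  using even_partI[of p f 0 g] by simp

text \<open>Multiplied out, the only term that may leave the module is \<open>b * g ^ 2\<close> with
  \<open>b\<close> a series in \<open>f\<close>, and there \<open>g ^ 2\<close> is \<open>h\<close>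
  up to an element of the module.\<close>

lemma even_part_mult:
  assumes f: "f $ 0 = 0" and g: "g ^ 2 - h \<in> even_part f g"
    and uw: "u \<in> even_part f g" "w \<in> even_part f g"
  shows "\<exists>a \<in> even_part f g. \<exists>b \<in> even_part f g. u * w = a + b * h"
proof -
  obtain p q p' q' where eq: "u = (p oo f) + (q oo f) * g" "w = (p' oo f) + (q' oo f) * g"
    using uw by (auto simp: even_part_def)
  define b where "b = (q * q') oo f"
  define a where "a = ((p * p') oo f) + ((p * q' + q * p') oo f) * g + b * (g ^ 2 - h)"
  have "u * w = a + b * h"
    unfolding eq a_def b_def fps_compose_mult_distrib[OF f] fps_compose_add_distrib
    by (simp add: algebra_simps power2_eq_square)
  moreover have "b \<in> even_part f g"
    unfolding b_def by (rule even_part_compose)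
  moreover have "a \<in> even_part f g"
    unfolding a_def b_def by (intro even_part_add even_partI even_part_mult_compose f g)
  ultimately show ?thesis by blast
qed

text \<open>The summands \<open>p oo f\<close> and \<open>(q oo f) * g\<close> have orders 0 and 2
  modulo 4, so their leading terms cannot cancel, and the second order is at least
  \<open>s\<close>.\<close>

lemma subdegree_even_part:
  fixes f g :: "'a::field fps"
  assumes f: "subdegree f = 4" and g: "g \<noteq> 0" "subdegree g = s" "s mod 4 = 2"
    and w: "w \<in> even_part f g" "w \<noteq> 0"
  shows "subdegree w mod 4 = 0 \<or> subdegree w mod 4 = 2 \<and> s \<le> subdegree w"
proof -
  have f0: "f $ 0 = 0" "f \<noteq> 0"
    using subdegree_pos_imp[of f] f by simp_all
  obtain p q where eq: "w = (p oo f) + (q oo f) * g"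
    using w by (auto simp: even_part_def)
  have P: "subdegree (p oo f) = 4 * subdegree p" for p
    using f by (simp add: f0)
  have Q: "subdegree ((q oo f) * g) = 4 * subdegree q + s" if "q \<noteq> 0"
    using that f0 g by (simp add: P fps_compose_eq_0_iff)
  consider "q = 0" | "p = 0" | "p \<noteq> 0" "q \<noteq> 0" by blast
  then show ?thesis
  proof cases
    case 1
    then show ?thesis by (simp add: eq P)
  next
    case 2
    with w(2) have "q \<noteq> 0"
      by (auto simp: eq)
    with 2 g show ?thesis by (simp add: eq Q)
  next
    case 3
    have nz: "p oo f \<noteq> 0" "(q oo f) * g \<noteq> 0"
      using 3 g f0 by (simp_all add: fps_compose_eq_0_iff)
    have ne: "4 * subdegree p \<noteq> 4 * subdegree q + s"
      using g(3) by presburger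
    then have "subdegree w = min (4 * subdegree p) (4 * subdegree q + s)"
      using subdegree_add_distinct(2)[OF nz] 3 by (simp add: eq P Q)
    then show ?thesis
      using g(3) by (auto simp: min_def)
  qed
qed

text \<open>Starting from \<open>g ^ 2\<close>, even leading terms are removed one after another by
  elements of the module, until an odd order appears or the order has passed the bound
  \<open>N\<close>.\<close>

lemma exists_odd_remainder:
  fixes f g :: "'a::field fps"
  assumes f: "f \<in> subalg G" "subdegree f = 4" and g: "g \<in> subalg G" "g \<noteq> 0" "subdegree g = s" "s mod 4 = 2"
    and ord: "\<And>n. n \<in> orders (subalg G) \<Longrightarrow> n mod 4 = 2 \<Longrightarrow> s \<le> n"
  shows "\<exists>h \<in> subalg G. g ^ 2 - h \<in> even_part f g \<and> (h \<noteq> 0 \<and> odd (subdegree h) \<or> fps_X ^ N dvd h)"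
proof (induction N)
  case 0
  show ?case
    using g(1) even_part_compose[of 0 f g] by (intro bexI[of _ "g ^ 2"]) auto
next
  case (Suc N)
  then obtain h where h: "h \<in> subalg G" "g ^ 2 - h \<in> even_part f g"
    "h \<noteq> 0 \<and> odd (subdegree h) \<or> fps_X ^ N dvd h" by blast
  show ?case
  proof (cases "h \<noteq> 0 \<and> odd (subdegree h) \<or> h $ N = 0")
    case True
    then have "h \<noteq> 0 \<and> odd (subdegree h) \<or> fps_X ^ Suc N dvd h"
      using h(3) unfolding fps_X_power_dvd_iff by (auto simp: less_Suc_eq)
    with h show ?thesis by blast
  next
    case False
    then have dvd: "fps_X ^ N dvd h" and nz: "h $ N \<noteq> 0" and ev: "h \<noteq> 0 \<longrightarrow> even (subdegree h)"
      using h(3) by auto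
    have hN: "h \<noteq> 0" "subdegree h = N"
      using dvd nz unfolding fps_X_power_dvd_iff by (auto intro: subdegreeI)
    then have N: "even N" "N \<in> orders (subalg G)"
      using ev ordersI[OF h(1)] by auto
    have f0: "f $ 0 = 0" "f \<noteq> 0"
      using subdegree_pos_imp[of f] f(2) by simp_all
    \<comment> \<open>A power of \<open>f\<close> if 4 divides \<open>N\<close>, otherwise a power
      of \<open>f\<close> times \<open>g\<close>; the latter needs \<open>s \<le> N\<close>, which
      is what \<open>ord\<close> provides.\<close>
    have "\<exists>e \<in> subalg G. e \<in> even_part f g \<and> e \<noteq> 0 \<and> subdegree e = N"
    proof (cases "N mod 4 = 0")
      case True
      then obtain k where k: "N = k * 4" by (metis mod_0_imp_dvd dvd_def mult.commute)
      have "f ^ k = fps_X ^ k oo f"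
        by (simp add: f0 fps_X_power_compose)
      then have "f ^ k \<in> even_part f g"
        by (simp only: even_part_compose)
      then show ?thesis
        using f f0 k by (intro bexI[of _ "f ^ k"]) auto
    next
      case False
      then have N2: "N mod 4 = 2"
        using N(1) by presburger
      then have "s \<le> N" "(N - s) mod 4 = 0"
        using ord[OF N(2)] g(4) by (auto simp: mod_eq_dvd_iff_nat[of s N 4, symmetric] simp flip: dvd_eq_mod_eq_0)
      then obtain k where k: "N = k * 4 + s"
        by (metis mod_0_imp_dvd dvd_def mult.commute le_add_diff_inverse2)
      have "f ^ k * g = (0 oo f) + (fps_X ^ k oo f) * g"
        by (simp add: f0 fps_X_power_compose)
      then have "f ^ k * g \<in> even_part f g"
        by (simp only: even_partI)
      moreover have "f ^ k * g \<noteq> 0" "subdegree (f ^ k * g) = N"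
        using f f0 g k by simp_all
      ultimately show ?thesis
        using f(1) g(1) by (intro bexI[of _ "f ^ k * g"]) auto
    qed
    then obtain e where e: "e \<in> subalg G" "e \<in> even_part f g" "e \<noteq> 0" "subdegree e = N"
      by blast
    define c where "c = h $ N / e $ N"
    have "g ^ 2 - (h - fps_const c * e) = (g ^ 2 - h) + (fps_const c oo f) * e"
      by simp
    also have "\<dots> \<in> even_part f g"
      by (intro even_part_add even_part_mult_compose f0 h e)
    finally have W: "g ^ 2 - (h - fps_const c * e) \<in> even_part f g" .
    have "e $ N \<noteq> 0"
      using e(3,4) nth_subdegree_nonzero by blast
    then have "(h - fps_const c * e) $ k = 0" if "k < Suc N" for k
      using that hN(2) e(4) nth_less_subdegree_zero[of k h] nth_less_subdegree_zero[of k e]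
      by (cases "k = N") (simp_all add: c_def)
    then have "fps_X ^ Suc N dvd h - fps_const c * e"
      unfolding fps_X_power_dvd_iff by blast
    with W h(1) e(1) show ?thesis by blast
  qed
qed

text \<open>Each product of two module elements produces at most one further factor
  \<open>h\<close>, so all excess is collected in \<open>h ^ 2 * r\<close> with an arbitrary series
  \<open>r\<close>; in the application \<open>h ^ 2\<close> is beyond the relevant
  precision.\<close>

lemma subalg_two_quadratic_normal_form:
  fixes f g :: "'a::field fps"
  assumes f: "f $ 0 = 0" and g: "g ^ 2 - h \<in> even_part f g" and u: "u \<in> subalg {f, g}"
  shows "\<exists>a \<in> even_part f g. \<exists>b \<in> even_part f g. \<exists>r. u = a + b * h + h ^ 2 * r"
proof -
  have W: "\<exists>a \<in> even_part f g. \<exists>b \<in> even_part f g. \<exists>r. w = a + b * h + h ^ 2 * r"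
    if "w \<in> even_part f g" for w
    using that even_part_compose[of 0 f g] by (intro bexI[of _ w] bexI[of _ 0] exI[of _ 0]) simp_all
  show ?thesis
    using u
  proof (induction rule: subalg.induct)
    case (const a)
    show ?case
      using even_part_compose[of "fps_const a" f g] by (intro W) simp
  next
    case (gen F)
    have "f \<in> even_part f g"
      using even_part_compose[of fps_X f g] f by simp
    moreover have "g \<in> even_part f g"
      using even_partI[of 0 f 1 g] by simp
    ultimately show ?case
      using gen by (intro W) blast
  next
    case (add F H)
    obtain a b r where F: "a \<in> even_part f g" "b \<in> even_part f g" "F = a + b * h + h ^ 2 * r"
      using add.IH(1) by blast
    obtain a' b' r' where H: "a' \<in> even_part f g" "b' \<in> even_part f g" "H = a' + b' * h + h ^ 2 * r'"
      using add.IH(2) by blast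
    show ?case
      using F H by (intro bexI[of _ "a + a'"] bexI[of _ "b + b'"] exI[of _ "r + r'"])
        (simp_all add: algebra_simps even_part_add)
  next
    case (mult F H)
    obtain a b r where F: "a \<in> even_part f g" "b \<in> even_part f g" "F = a + b * h + h ^ 2 * r"
      using mult.IH(1) by blast
    obtain a' b' r' where H: "a' \<in> even_part f g" "b' \<in> even_part f g" "H = a' + b' * h + h ^ 2 * r'"
      using mult.IH(2) by blast
    obtain p q where pq: "p \<in> even_part f g" "q \<in> even_part f g" "a * a' = p + q * h"
      using even_part_mult[OF f g F(1) H(1)] by blast
    obtain p1 q1 where pq1: "p1 \<in> even_part f g" "q1 \<in> even_part f g" "a * b' = p1 + q1 * h"
      using even_part_mult[OF f g F(1) H(2)] by blast
    obtain p2 q2 where pq2: "p2 \<in> even_part f g" "q2 \<in> even_part f g" "b * a' = p2 + q2 * h"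
      using even_part_mult[OF f g F(2) H(1)] by blast
    have "F * H = a * a' + (a * b' + b * a') * h
        + h ^ 2 * (b * b' + (a + b * h) * r' + r * (a' + b' * h) + h ^ 2 * r * r')"
      unfolding F(3) H(3) by (simp add: algebra_simps power2_eq_square)
    also have "\<dots> = p + (q + p1 + p2) * h
        + h ^ 2 * (q1 + q2 + b * b' + (a + b * h) * r' + r * (a' + b' * h) + h ^ 2 * r * r')"
      unfolding pq(3) pq1(3) pq2(3) by (simp add: algebra_simps power2_eq_square)
    finally show ?case
      using pq pq1 pq2 by (meson even_part_add)
  qed
qed

section \<open>Semigroups of multiplicity four\<close>

lemma mod_4_add:
  fixes a b r s t :: nat
  assumes "a mod 4 = r" "b mod 4 = s" "(r + s) mod 4 = t"
  shows "(a + b) mod 4 = t"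
  using mod_add_eq[of a 4 b] unfolding assms by (rule sym)

lemma odd_iff_mod_4: "odd n \<longleftrightarrow> n mod 4 = 1 \<or> n mod 4 = 3" for n :: nat
  by presburger

text \<open>The inequalities \<open>indecomposable\<close> are the consequences of embedding
  dimension four on which the argument is built.\<close>

locale four_generated =
  fixes x1 x2 x3 :: nat
  assumes big: "4 < x1" "4 < x2" "4 < x3"
    and residues: "x1 mod 4 = 1" "x2 mod 4 = 2" "x3 mod 4 = 3"
    and indecomposable: "x3 < x1 + x2" "x1 < x3 + x2" "x2 < 2 * x1" "x2 < 2 * x3"
begin

text \<open>Description by the Apery set with respect to 4: \<open>0\<close>, \<open>x1\<close>,
  \<open>x2\<close>, \<open>x3\<close> are the least elements of the residue classes. It is
  identified with the generated semigroup in \<open>sg_gen_eq_S\<close>.\<close>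

definition S :: "nat set" where
  "S = {n. n mod 4 = 0 \<or> n mod 4 = 1 \<and> x1 \<le> n \<or> n mod 4 = 2 \<and> x2 \<le> n \<or> n mod 4 = 3 \<and> x3 \<le> n}"

lemma parity: "odd x1" "even x2" "odd x3"
  using odd_iff_mod_4[of x1] odd_iff_mod_4[of x2] odd_iff_mod_4[of x3] unfolding residues by simp_all

lemma sum_residues:
  "(x1 + x1) mod 4 = 2" "(x1 + x3) mod 4 = 0" "(x3 + x3) mod 4 = 2"
  "(x1 + x2) mod 4 = 3" "(x3 + x2) mod 4 = 1" "(x2 + x2) mod 4 = 0"
  "(x1 + 2) mod 4 = 3" "(x3 + 2) mod 4 = 1"
  by (rule mod_4_add[OF residues(1) residues(1)], simp,
    rule mod_4_add[OF residues(1) residues(3)], simp,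
    rule mod_4_add[OF residues(3) residues(3)], simp,
    rule mod_4_add[OF residues(1) residues(2)], simp,
    rule mod_4_add[OF residues(3) residues(2)], simp,
    rule mod_4_add[OF residues(2) residues(2)], simp,
    rule mod_4_add[OF residues(1) refl], simp,
    rule mod_4_add[OF residues(3) refl], simp)

lemma S_add:
  assumes "a \<in> S" "b \<in> S"
  shows "a + b \<in> S"
proof -
  \<comment> \<open>Stated for free residues \<open>i\<close> and \<open>j\<close>, the claim is a
    finite case check against \<open>indecomposable\<close>.\<close>
  have "(i + j) mod 4 = 0 \<or> (i + j) mod 4 = 1 \<and> x1 \<le> a + b \<or> (i + j) mod 4 = 2 \<and> x2 \<le> a + b
      \<or> (i + j) mod 4 = 3 \<and> x3 \<le> a + b"
    if "i = 0 \<or> i = 1 \<and> x1 \<le> a \<or> i = 2 \<and> x2 \<le> a \<or> i = 3 \<and> x3 \<le> a"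
      "j = 0 \<or> j = 1 \<and> x1 \<le> b \<or> j = 2 \<and> x2 \<le> b \<or> j = 3 \<and> x3 \<le> b" for i j :: nat
    using that indecomposable by (elim disjE conjE) simp_all
  from this[OF assms[unfolded S_def mem_Collect_eq], unfolded mod_add_eq] show ?thesis
    unfolding S_def mem_Collect_eq .
qed

lemma zero_in_S: "0 \<in> S"
  by (simp add: S_def)

lemma S_mult: "a \<in> S \<Longrightarrow> k * a \<in> S"
  by (induction k) (simp_all add: S_add zero_in_S)

lemma generators_in_S: "4 \<in> S" "x1 \<in> S" "x2 \<in> S" "x3 \<in> S"
  using residues by (simp_all add: S_def)

lemma S_cases:
  assumes "n \<in> S"
  obtains k y where "y \<in> {0, x1, x2, x3}" "n = k * 4 + y"
proof -
  have "\<exists>y \<in> {0, x1, x2, x3}. y mod 4 = n mod 4 \<and> y \<le> n"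
    using assms residues unfolding S_def mem_Collect_eq by (elim disjE) simp_all
  then obtain y where y: "y \<in> {0, x1, x2, x3}" "y mod 4 = n mod 4" "y \<le> n"
    by blast
  then have "4 dvd n - y"
    using mod_eq_dvd_iff_nat[OF y(3), of 4] by (simp only: simp_thms)
  then obtain k where "n - y = 4 * k" ..
  with y(3) have "n = k * 4 + y"
    by simp
  with y(1) that show thesis by blast
qed

lemma sg_gen_eq_S: "sg_gen {4, x1, x2, x3} = S"
proof -
  have cong: "[x1 = 1] (mod 4)" "[x2 = 2] (mod 4)" "[x3 = 3] (mod 4)"
    using residues by (simp_all add: cong_def)
  show ?thesis
    unfolding sg_gen_four[OF cong]
  proof (intro equalityI subsetI)
    fix n assume "n \<in> {a * 4 + b * x1 + c * x2 + d * x3 |a b c d. True}"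
    then obtain a b c d where "n = a * 4 + b * x1 + c * x2 + d * x3" by blast
    then show "n \<in> S"
      by (simp add: S_add S_mult generators_in_S)
  next
    fix n assume "n \<in> S"
    then obtain k y where "y \<in> {0, x1, x2, x3}" "n = k * 4 + y"
      by (rule S_cases)
    then have "n = k * 4 + 0 * x1 + 0 * x2 + 0 * x3 \<or> n = k * 4 + 1 * x1 + 0 * x2 + 0 * x3
        \<or> n = k * 4 + 0 * x1 + 1 * x2 + 0 * x3 \<or> n = k * 4 + 0 * x1 + 0 * x2 + 1 * x3"
      by auto
    then show "n \<in> {a * 4 + b * x1 + c * x2 + d * x3 |a b c d. True}"
      by blast
  qed
qed

text \<open>Each \<open>x1\<close>, \<open>x2\<close>, \<open>x3\<close> is the least element of its
  residue class in \<open>S\<close>, so subtracting 4 leaves \<open>S\<close>; for 4 itself only 0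
  would remain.\<close>

lemma generator_not_decomposable:
  assumes "j \<in> {4, x1, x2, x3}" "s \<in> S" "s \<noteq> 0"
  shows "j \<noteq> 4 + s"
proof
  assume j: "j = 4 + s"
  then have "j mod 4 = s mod 4" by simp
  then show False
    using assms j residues by (auto simp: S_def)
qed

text \<open>Below the least of the \<open>xi\<close> the semigroup contains only multiples of 4, so
  the bound on indecomposable orders applies with \<open>m = 4\<close>.\<close>

lemma card_generators_le:
  fixes C :: "nat \<Rightarrow> 'a::field fps"
  assumes C: "\<And>i. i < d \<Longrightarrow> C i $ 0 = 0" and S: "orders (subalg (C ` {..<d})) = S"
    and J: "J \<subseteq> {4, x1, x2, x3}" "\<And>j. j \<in> J \<Longrightarrow> j < 2 * Min {x1, x2, x3}"
  shows "card J \<le> d"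
proof (rule card_indecomposable_orders_le)
  show "4 dvd s" if "s \<in> orders (subalg (C ` {..<d}))" "s < Min {x1, x2, x3}" for s
    using that unfolding S by (auto simp: S_def)
  show "finite J"
    using J(1) by (rule finite_subset) simp
  show "J \<subseteq> orders (subalg (C ` {..<d}))"
    using J(1) generators_in_S unfolding S by blast
  show "0 < j \<and> j < 2 * Min {x1, x2, x3}" if "j \<in> J" for j
    using J(1) J(2)[OF that] that big by auto
  show "j \<noteq> 4 + s" if "j \<in> J" "s \<in> orders (subalg (C ` {..<d}))" "s \<noteq> 0" for j s
    using generator_not_decomposable[of j s] that J(1) unfolding S by blast
qed (simp_all add: C S generators_in_S)

section \<open>Exclusion of plane curves\<close>

text \<open>Two components leave room for only 4 and \<open>\<mu>\<close> below
  \<open>2 * \<mu>\<close>. An odd minimum would then contradict \<open>x2 < 2 * x1\<close> or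
  \<open>x2 < 2 * x3\<close>, and parity makes the remaining inequalities strict.\<close>

lemma plane_generators_gap:
  fixes C :: "nat \<Rightarrow> 'a::field fps"
  assumes C: "\<And>i. i < 2 \<Longrightarrow> C i $ 0 = 0" and S: "orders (subalg (C ` {..<2})) = S"
  shows "x2 \<le> x1" "x2 \<le> x3" "2 * x2 < x1" "2 * x2 < x3"
proof -
  define \<mu> where "\<mu> = Min {x1, x2, x3}"
  have \<mu>: "\<mu> \<in> {x1, x2, x3}" "\<mu> \<le> x1" "\<mu> \<le> x2" "\<mu> \<le> x3"
    unfolding \<mu>_def by (rule Min_in) simp_all
  have gap: "2 * \<mu> \<le> y" if "y \<in> {x1, x2, x3}" "y \<noteq> \<mu>" for y
  proof (rule ccontr)
    assume "\<not> 2 * \<mu> \<le> y"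
    then have "card {4, \<mu>, y} \<le> 2"
      using \<mu> that(1) big by (intro card_generators_le[OF C S]) (auto simp: \<mu>_def[symmetric])
    moreover have "card {4, \<mu>, y} = 3"
      using \<mu>(1) that big by auto
    ultimately show False by simp
  qed
  have ne: "x1 \<noteq> x2" "x1 \<noteq> x3" "x2 \<noteq> x3"
    using residues by auto
  have "\<mu> \<noteq> x1" "\<mu> \<noteq> x3"
    using gap[of x2] ne indecomposable by auto
  then have eq: "\<mu> = x2"
    using \<mu>(1) by blast
  show "x2 \<le> x1" "x2 \<le> x3"
    using \<mu> eq by simp_all
  have "2 * x2 \<le> x1" "2 * x2 \<le> x3"
    using gap[of x1] gap[of x3] ne eq by auto
  moreover have "2 * x2 \<noteq> x1" "2 * x2 \<noteq> x3"
    using parity by auto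
  ultimately show "2 * x2 < x1" "2 * x2 < x3"
    by simp_all
qed

text \<open>Elements \<open>f\<close>, \<open>g\<close> of orders 4 and \<open>x2\<close>
  approximate the whole algebra, so odd orders up to \<open>z\<close> are visible in normal forms
  \<open>a + b * h\<close>. The least odd order \<open>y\<close> forces
  \<open>subdegree h = y\<close>; then \<open>z\<close> is \<open>y\<close> plus an order of
  \<open>even_part f g\<close> that is 2 modulo 4, hence at least \<open>y + x2\<close>, against
  \<open>z < y + x2\<close>.\<close>

lemma not_plane:
  fixes C :: "nat \<Rightarrow> 'a::field fps"
  assumes C: "\<And>i. i < 2 \<Longrightarrow> C i $ 0 = 0" and S: "orders (subalg (C ` {..<2})) = S"
  shows False
proof -
  define G where "G = C ` {..<2}"
  note gap = plane_generators_gap[OF C S]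
  have ord: "orders (subalg G) = S"
    using S by (simp add: G_def)
  obtain f where f: "f \<in> subalg G" "f \<noteq> 0" "subdegree f = 4"
    using generators_in_S(1) unfolding ord[symmetric] by (rule ordersE)
  obtain g where g: "g \<in> subalg G" "g \<noteq> 0" "subdegree g = x2"
    using generators_in_S(3) unfolding ord[symmetric] by (rule ordersE)
  have fg0: "f $ 0 = 0" "g $ 0 = 0"
    using subdegree_pos_imp(1)[of f] subdegree_pos_imp(1)[of g] f(3) g(3) big by simp_all
  \<comment> \<open>A nontrivial combination has order 4 or \<open>x2\<close>; both are below
    \<open>2 * x2\<close> and indecomposable, hence not orders in the square of the maximal
    ideal.\<close>
  have indep: "fps_const a * f + fps_const b * g \<notin> max_ideal_sq G" if "a \<noteq> 0 \<or> b \<noteq> 0" for a b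
  proof
    assume max_ideal_sq: "fps_const a * f + fps_const b * g \<in> max_ideal_sq G"
    define q where "q = (\<Sum>j\<in>{4, x2}. fps_const (if j = 4 then a else b) * (if j = 4 then f else g))"
    have q_eq: "q = fps_const a * f + fps_const b * g"
      using big by (auto simp: q_def)
    define j0 where "j0 = (if a \<noteq> 0 then 4 else x2)"
    have j0: "j0 \<in> {4, x2}" "(if j0 = 4 then a else b) \<noteq> 0"
      using \<open>a \<noteq> 0 \<or> b \<noteq> 0\<close> big by (simp_all add: j0_def)
    have "(if j = 4 then f else g) \<noteq> 0 \<and> subdegree (if j = 4 then f else g) = j"
      if "j \<in> {4, x2}" for j
      using that f g by auto
    note q = subdegree_combination[where l = "\<lambda>j. if j = 4 then a else b", OF _ this j0, folded q_def]
    have q: "q \<noteq> 0" "subdegree q \<in> {4, x2}"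
      by (rule q; simp)+
    have "\<exists>s\<in>orders (subalg G). s \<noteq> 0 \<and> subdegree q = 4 + s"
    proof (rule orders_max_ideal_sq[where \<mu> = x2])
      show "4 dvd s" if "s \<in> orders (subalg G)" "s < x2" for s
        using that gap unfolding ord by (auto simp: S_def)
      show "q \<in> max_ideal_sq G"
        using max_ideal_sq by (simp add: q_eq)
      show "subdegree q < 2 * x2"
        using q(2) big by auto
    qed (use f q in auto)
    then show False
      using generator_not_decomposable[of "subdegree q"] q(2) unfolding ord by blast
  qed
  have "\<exists>a b. u - fps_const a * f - fps_const b * g \<in> max_ideal_sq G" if "u \<in> max_ideal G" for u
    unfolding G_def
    by (rule span_mod_max_ideal_sq)
      (use C f(1) g(1) fg0 indep that in \<open>auto simp: G_def[symmetric] max_ideal_def\<close>)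
  note dense = subalg_two_dense[OF fg0 this]
  define y where "y = min x1 x3"
  define z where "z = max x1 x3"
  have yz: "y \<in> S" "z \<in> S" "odd y" "z < y + x2" "y < z" "z mod 4 = (y + 2) mod 4" "2 * x2 < y"
  proof -
    consider "x1 < x3" | "x3 < x1"
      using residues by force
    then have "y \<in> S \<and> z \<in> S \<and> odd y \<and> z < y + x2 \<and> y < z \<and> z mod 4 = (y + 2) mod 4 \<and> 2 * x2 < y"
    proof cases
      case 1
      then have "y = x1" "z = x3" by (simp_all add: y_def z_def)
      moreover have "odd x1" "x3 mod 4 = (x1 + 2) mod 4"
        by (simp_all only: parity residues sum_residues simp_thms)
      ultimately show ?thesis
        using 1 generators_in_S indecomposable gap by simp
    next
      case 2
      then have "y = x3" "z = x1" by (simp_all add: y_def z_def)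
      moreover have "odd x3" "x1 mod 4 = (x3 + 2) mod 4"
        by (simp_all only: parity residues sum_residues simp_thms)
      ultimately show ?thesis
        using 2 generators_in_S indecomposable gap by simp
    qed
    then show "y \<in> S" "z \<in> S" "odd y" "z < y + x2" "y < z" "z mod 4 = (y + 2) mod 4" "2 * x2 < y"
      by simp_all
  qed
  have odd_ge: "y \<le> n" if "n \<in> S" "odd n" for n
  proof -
    have "n mod 4 = 1 \<or> n mod 4 = 3"
      using that(2) by (simp only: odd_iff_mod_4)
    then show ?thesis
      using that(1) by (auto simp: S_def y_def)
  qed
  \<comment> \<open>Precision \<open>z + 1\<close> suffices, as no order beyond \<open>z\<close> is
    examined.\<close>
  obtain h where h: "h \<in> subalg G" "g ^ 2 - h \<in> even_part f g"
    "h \<noteq> 0 \<and> odd (subdegree h) \<or> fps_X ^ (z + 1) dvd h"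
    using exists_odd_remainder[where f = f and G = G and g = g and s = x2 and N = "z + 1"]
      f g residues ord by (auto simp: S_def)
  have approx: "\<exists>a b. a \<in> even_part f g \<and> b \<in> even_part f g \<and> a + b * h \<noteq> 0 \<and> subdegree (a + b * h) = n"
    if n: "n \<in> S" "n \<le> z" for n
  proof -
    obtain u where u: "u \<in> subalg G" "u \<noteq> 0" "subdegree u = n"
      using n(1) unfolding ord[symmetric] by (rule ordersE)
    obtain w where w: "w \<in> subalg {f, g}" "fps_X ^ (z + 1) dvd u - w"
      using dense[OF _ u(1)] by blast
    obtain a b r where abr: "a \<in> even_part f g" "b \<in> even_part f g" "w = a + b * h + h ^ 2 * r"
      using subalg_two_quadratic_normal_form[OF fg0(1) h(2) w(1)] by blast
    \<comment> \<open>If \<open>h\<close> is not already negligible, its order is odd and so at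
      least \<open>y\<close>; then \<open>h ^ 2\<close> has order at least
      \<open>2 * y > y + x2 > z\<close>.\<close>
    have "fps_X ^ (z + 1) dvd h ^ 2"
    proof (cases "fps_X ^ (z + 1) dvd h")
      case True
      then show ?thesis by (simp add: power2_eq_square)
    next
      case False
      then have "h \<noteq> 0" "y \<le> subdegree h"
        using h(3) odd_ge[of "subdegree h"] ordersI[OF h(1)] ord by auto
      then have "z + 1 \<le> subdegree (h ^ 2)"
        using yz by (simp add: subdegree_power)
      then show ?thesis
        using \<open>h \<noteq> 0\<close> fps_dvd_iff[of "fps_X ^ (z + 1)" "h ^ 2"] by simp
    qed
    then have "fps_X ^ (z + 1) dvd (u - w) + h ^ 2 * r"
      using w(2) by (simp add: dvd_add)
    then have "fps_X ^ (z + 1) dvd u - (a + b * h)"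
      by (simp add: abr(3) algebra_simps)
    from subdegree_eq_of_dvd_diff[OF this u(2)] n(2) u(3) abr(1,2) show ?thesis
      by auto
  qed
  have even: "subdegree a mod 4 = 0 \<or> subdegree a mod 4 = 2 \<and> x2 \<le> subdegree a"
    if "a \<in> even_part f g" "a \<noteq> 0" for a
    using subdegree_even_part[OF f(3) g(2,3) residues(2) that] .
  have even': "even (subdegree a)" if "a \<in> even_part f g" "a \<noteq> 0" for a
    using even[OF that] by presburger
  \<comment> \<open>Nonzero \<open>a\<close> and \<open>b\<close> have even orders, so an odd order
    must come from \<open>b * h\<close> with \<open>h\<close> of odd order; otherwise
    \<open>h\<close> vanishes up to degree \<open>z\<close> and \<open>a\<close> alone would carry
    the order.\<close>
  have oddpart: "b \<noteq> 0 \<and> h \<noteq> 0 \<and> odd (subdegree h) \<and> n = subdegree b + subdegree h"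
    if ab: "a \<in> even_part f g" "b \<in> even_part f g" "a + b * h \<noteq> 0" "subdegree (a + b * h) = n"
      and n: "odd n" "n \<le> z" for a b n
  proof -
    have a: "a = 0 \<or> even (subdegree a)"
      using even'[OF ab(1)] by (cases "a = 0") simp_all
    have bh: "b * h \<noteq> 0"
      using a ab(3,4) n(1) by auto
    have "odd (subdegree h)"
    proof (rule ccontr)
      assume "\<not> odd (subdegree h)"
      then have "fps_X ^ (z + 1) dvd b * h"
        using h(3) by simp
      then have "fps_X ^ (z + 1) dvd (a + b * h) - a"
        by simp
      from subdegree_eq_of_dvd_diff[OF this ab(3)] ab(4) n a show False
        by simp
    qed
    moreover have "even (subdegree b)"
      using even'[OF ab(2)] bh by simp
    ultimately have odd_bh: "odd (subdegree (b * h))"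
      using bh by simp
    have "n = subdegree (b * h)"
    proof (cases "a = 0")
      case True
      then show ?thesis using ab(4) by simp
    next
      case False
      then have "subdegree a \<noteq> subdegree (b * h)"
        using a odd_bh by auto
      then have "n = min (subdegree a) (subdegree (b * h))"
        using subdegree_add_distinct(2)[OF False bh] ab(4) by simp
      then show ?thesis
        using n(1) a False by (auto simp: min_def split: if_splits)
    qed
    with bh \<open>odd (subdegree h)\<close> show ?thesis
      by auto
  qed
  obtain a b where ab: "a \<in> even_part f g" "b \<in> even_part f g" "a + b * h \<noteq> 0" "subdegree (a + b * h) = y"
    using approx[OF yz(1)] yz(5) by auto
  have y: "h \<noteq> 0" "odd (subdegree h)" "subdegree h \<le> y"
    using oddpart[OF ab yz(3)] yz(5) by auto
  then have hy: "subdegree h = y"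
    using odd_ge[of "subdegree h"] ordersI[OF h(1)] ord by auto
  obtain a b where ab: "a \<in> even_part f g" "b \<in> even_part f g" "a + b * h \<noteq> 0" "subdegree (a + b * h) = z"
    using approx[OF yz(2)] by auto
  have "odd z"
    using yz(3,6) by presburger
  then have z: "b \<noteq> 0" "z = subdegree b + y"
    using oddpart[OF ab] hy by auto
  \<comment> \<open>The two odd generators differ by 2 modulo 4.\<close>
  then have "subdegree b mod 4 = 2"
    using yz(6) by presburger
  then have "x2 \<le> subdegree b"
    using even[OF ab(2) z(1)] by auto
  with z(2) yz(4) show False by simp
qed

end

section \<open>Construction of curves\<close>

context four_generated
begin

definition order_in :: "nat set \<Rightarrow> 'a::field fps \<Rightarrow> bool" where
  "order_in T F \<longleftrightarrow> F = 0 \<or> subdegree F \<in> S \<and> subdegree F mod 4 \<in> T"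

lemma order_in_add:
  assumes "order_in T F" "order_in T' H" "T \<inter> T' = {}"
  shows "order_in (T \<union> T') (F + H)"
proof (cases "F = 0 \<or> H = 0")
  case True
  then show ?thesis
    using assms(1,2) by (auto simp: order_in_def)
next
  case False
  then have FH: "subdegree F \<in> S" "subdegree F mod 4 \<in> T" "subdegree H \<in> S" "subdegree H mod 4 \<in> T'"
    using assms(1,2) by (simp_all add: order_in_def)
  then have "subdegree F \<noteq> subdegree H"
    using assms(3) by (metis disjoint_iff)
  then have "subdegree (F + H) = min (subdegree F) (subdegree H)"
    using subdegree_add_distinct(2)[of F H] False by simp
  then show ?thesis
    using FH by (cases "subdegree F \<le> subdegree H") (simp_all add: order_in_def)
qed

lemma order_in_compose_mult:
  fixes F :: "'a::field fps"
  assumes "F \<noteq> 0" "subdegree F \<in> S"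
  shows "order_in {subdegree F mod 4} ((p oo fps_X ^ 4) * F)"
proof (cases "p = 0")
  case False
  then have "subdegree ((p oo fps_X ^ 4) * F) = subdegree p * 4 + subdegree F"
    using assms(1) by (simp add: fps_compose_eq_0_iff subdegree_power)
  then show ?thesis
    using S_add[OF S_mult[OF generators_in_S(1)] assms(2)] by (simp add: order_in_def)
qed (simp add: order_in_def)

section \<open>A module over \<open>K[[t^4]]\<close> with prescribed orders\<close>

text \<open>The \<open>K[[t^4]]\<close>-module on \<open>1\<close>, \<open>t^x1\<close>,
  \<open>H\<close>, \<open>t^x3\<close>. For \<open>H\<close> of order \<open>x2\<close> these have
  the least orders of the four residue classes; the module will contain the algebra of the curve and
  so bound its orders.\<close>

definition free_module :: "'a::field fps \<Rightarrow> 'a fps set" where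
  "free_module H = {(p oo fps_X ^ 4) * 1 + (q oo fps_X ^ 4) * fps_X ^ x1 + (r oo fps_X ^ 4) * H
    + (s oo fps_X ^ 4) * fps_X ^ x3 | p q r s. True}"

lemma free_moduleI:
  "(p oo fps_X ^ 4) * 1 + (q oo fps_X ^ 4) * fps_X ^ x1 + (r oo fps_X ^ 4) * H
    + (s oo fps_X ^ 4) * fps_X ^ x3 \<in> free_module H"
  unfolding free_module_def by blast

lemma free_moduleE:
  assumes "u \<in> free_module H"
  obtains p q r s where "u = (p oo fps_X ^ 4) * 1 + (q oo fps_X ^ 4) * fps_X ^ x1
    + (r oo fps_X ^ 4) * H + (s oo fps_X ^ 4) * fps_X ^ x3"
  using assms unfolding free_module_def by blast

lemma free_module_add:
  assumes "u \<in> free_module H" "w \<in> free_module H"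
  shows "u + w \<in> free_module H"
proof -
  obtain p q r s where u: "u = (p oo fps_X ^ 4) * 1 + (q oo fps_X ^ 4) * fps_X ^ x1
      + (r oo fps_X ^ 4) * H + (s oo fps_X ^ 4) * fps_X ^ x3"
    using assms(1) by (rule free_moduleE)
  obtain p' q' r' s' where w: "w = (p' oo fps_X ^ 4) * 1 + (q' oo fps_X ^ 4) * fps_X ^ x1
      + (r' oo fps_X ^ 4) * H + (s' oo fps_X ^ 4) * fps_X ^ x3"
    using assms(2) by (rule free_moduleE)
  have "u + w = ((p + p') oo fps_X ^ 4) * 1 + ((q + q') oo fps_X ^ 4) * fps_X ^ x1
      + ((r + r') oo fps_X ^ 4) * H + ((s + s') oo fps_X ^ 4) * fps_X ^ x3"
    unfolding u w fps_compose_add_distrib by (simp add: algebra_simps)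
  then show ?thesis
    by (simp only: free_moduleI)
qed

lemma free_module_scale:
  assumes "w \<in> free_module H"
  shows "(t oo fps_X ^ 4) * w \<in> free_module H"
proof -
  obtain p q r s where w: "w = (p oo fps_X ^ 4) * 1 + (q oo fps_X ^ 4) * fps_X ^ x1
      + (r oo fps_X ^ 4) * H + (s oo fps_X ^ 4) * fps_X ^ x3"
    using assms by (rule free_moduleE)
  have X: "(fps_X ^ 4 :: 'a fps) $ 0 = 0"
    by simp
  have "(t oo fps_X ^ 4) * w = ((t * p) oo fps_X ^ 4) * 1 + ((t * q) oo fps_X ^ 4) * fps_X ^ x1
      + ((t * r) oo fps_X ^ 4) * H + ((t * s) oo fps_X ^ 4) * fps_X ^ x3"
    unfolding w fps_compose_mult_distrib[OF X] by (simp add: algebra_simps)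
  then show ?thesis
    by (simp only: free_moduleI)
qed

lemma free_module_basis:
  "1 \<in> free_module H" "fps_X ^ x1 \<in> free_module H" "H \<in> free_module H" "fps_X ^ x3 \<in> free_module H"
  using free_moduleI[of 1 0 0 H 0] free_moduleI[of 0 1 0 H 0] free_moduleI[of 0 0 1 H 0]
    free_moduleI[of 0 0 0 H 1] by simp_all

lemma free_module_const: "fps_const a * w \<in> free_module H" if "w \<in> free_module H"
  using free_module_scale[OF that, of "fps_const a"] by simp

lemma free_module_shift: "fps_X ^ (4 * k) * w \<in> free_module H" if "w \<in> free_module H"
  using free_module_scale[OF that, of "fps_X ^ k"] by (simp add: fps_X_power_compose power_mult)

text \<open>Bilinearity over \<open>K[[t^4]]\<close> reduces closure to products of generators, and
  commutativity leaves six of them.\<close>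

lemma free_module_mult:
  fixes H :: "'a::field fps"
  assumes prod: "fps_X ^ x1 * fps_X ^ x1 \<in> free_module H" "fps_X ^ x1 * H \<in> free_module H"
      "fps_X ^ x1 * fps_X ^ x3 \<in> free_module H" "H * H \<in> free_module H"
      "fps_X ^ x3 * H \<in> free_module H" "fps_X ^ x3 * fps_X ^ x3 \<in> free_module H"
    and uw: "u \<in> free_module H" "w \<in> free_module H"
  shows "u * w \<in> free_module H"
proof -
  have basis: "g * w \<in> free_module H"
    if g: "g * fps_X ^ x1 \<in> free_module H" "g * H \<in> free_module H" "g * fps_X ^ x3 \<in> free_module H"
      "g \<in> free_module H" and w: "w \<in> free_module H" for g w
  proof -
    obtain p q r s where w: "w = (p oo fps_X ^ 4) * 1 + (q oo fps_X ^ 4) * fps_X ^ x1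
        + (r oo fps_X ^ 4) * H + (s oo fps_X ^ 4) * fps_X ^ x3"
      using w by (rule free_moduleE)
    have "g * w = (p oo fps_X ^ 4) * g + (q oo fps_X ^ 4) * (g * fps_X ^ x1)
        + (r oo fps_X ^ 4) * (g * H) + (s oo fps_X ^ 4) * (g * fps_X ^ x3)"
      unfolding w by (simp add: algebra_simps)
    then show ?thesis
      using g by (simp only: free_module_add free_module_scale)
  qed
  have comm: "H * fps_X ^ x1 \<in> free_module H" "H * fps_X ^ x3 \<in> free_module H"
    "fps_X ^ x3 * fps_X ^ x1 \<in> free_module H"
    using prod by (simp_all only: mult.commute)
  have "fps_X ^ x1 * w \<in> free_module H" "H * w \<in> free_module H" "fps_X ^ x3 * w \<in> free_module H"
    by (rule basis[OF prod(1,2,3) free_module_basis(2) uw(2)],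
        rule basis[OF comm(1) prod(4) comm(2) free_module_basis(3) uw(2)],
        rule basis[OF comm(3) prod(5,6) free_module_basis(4) uw(2)])
  moreover obtain p q r s where u: "u = (p oo fps_X ^ 4) * 1 + (q oo fps_X ^ 4) * fps_X ^ x1
      + (r oo fps_X ^ 4) * H + (s oo fps_X ^ 4) * fps_X ^ x3"
    using uw(1) by (rule free_moduleE)
  moreover have "u * w = (p oo fps_X ^ 4) * w + (q oo fps_X ^ 4) * (fps_X ^ x1 * w)
      + (r oo fps_X ^ 4) * (H * w) + (s oo fps_X ^ 4) * (fps_X ^ x3 * w)"
    unfolding u by (simp add: algebra_simps)
  ultimately show ?thesis
    using uw(2) by (simp only: free_module_add free_module_scale)
qed

text \<open>The four summands have orders in different residue classes, so no leading terms
  cancel.\<close>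

lemma order_in_free_module:
  fixes H :: "'a::field fps"
  assumes H: "H \<noteq> 0" "subdegree H = x2" and u: "u \<in> free_module H" "u \<noteq> 0"
  shows "subdegree u \<in> S"
proof -
  obtain p q r s where eq: "u = (p oo fps_X ^ 4) * 1 + (q oo fps_X ^ 4) * fps_X ^ x1
      + (r oo fps_X ^ 4) * H + (s oo fps_X ^ 4) * fps_X ^ x3"
    using u(1) by (rule free_moduleE)
  have "order_in {0} ((p oo fps_X ^ 4) * 1)"
    using order_in_compose_mult[of "1 :: 'a fps" p] zero_in_S by simp
  moreover have "order_in {1} ((q oo fps_X ^ 4) * fps_X ^ x1)"
    using order_in_compose_mult[of "fps_X ^ x1 :: 'a fps" q] generators_in_S residues
    by (simp add: subdegree_power)
  moreover have "order_in {2} ((r oo fps_X ^ 4) * H)"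
    using order_in_compose_mult[of H r] generators_in_S residues H by simp
  moreover have "order_in {3} ((s oo fps_X ^ 4) * fps_X ^ x3)"
    using order_in_compose_mult[of "fps_X ^ x3 :: 'a fps" s] generators_in_S residues
    by (simp add: subdegree_power)
  ultimately have "order_in ({0} \<union> {1} \<union> {2} \<union> {3}) u"
    unfolding eq by (intro order_in_add) simp_all
  with u(2) show ?thesis
    by (simp add: order_in_def)
qed

text \<open>Outside residue 2, \<open>t^n\<close> is a power of \<open>t^4\<close> times a
  generator. In residue 2, \<open>t^(4k) * H\<close> equals \<open>t^n + c * t^(e + 4k)\<close>, and
  the odd exponent \<open>e + 4k\<close> must itself be in \<open>S\<close>.\<close>

lemma fps_X_power_in_free_module:
  fixes c :: "'a::field" and e :: nat
  defines "H \<equiv> fps_X ^ x2 + fps_const c * fps_X ^ e"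
  assumes n: "n \<in> S" and e: "odd e" "n mod 4 = 2 \<Longrightarrow> e + (n - x2) \<in> S"
  shows "fps_X ^ n \<in> free_module H"
proof -
  have *: "fps_X ^ n \<in> free_module H" if n: "n \<in> S" "n mod 4 \<noteq> 2" for n
  proof -
    obtain k y where y: "y \<in> {0, x1, x2, x3}" "n = k * 4 + y"
      using n(1) by (rule S_cases)
    then have "n mod 4 = y mod 4"
      by simp
    with n(2) residues(2) have "y \<noteq> x2"
      by auto
    then have "fps_X ^ y \<in> free_module H"
      using y(1) free_module_basis[of H] by auto
    then show ?thesis
      using free_module_shift[of "fps_X ^ y" H k] y(2) by (simp add: power_add mult.commute)
  qed
  show ?thesis
  proof (cases "n mod 4 = 2")
    case True
    have "x2 \<le> n"
      using n True by (simp add: S_def)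
    moreover have "4 dvd n - x2"
      using mod_eq_dvd_iff_nat[OF \<open>x2 \<le> n\<close>, of 4] True residues(2) by simp
    ultimately obtain k where k: "n = x2 + 4 * k"
      by (metis dvdE le_add_diff_inverse)
    have "(e + 4 * k) mod 4 \<noteq> 2"
      using e(1) by presburger
    then have "fps_X ^ (e + 4 * k) \<in> free_module H"
      using e(2)[OF True] k by (intro *) simp_all
    then have "fps_X ^ (4 * k) * H + fps_const (- c) * fps_X ^ (e + 4 * k) \<in> free_module H"
      by (intro free_module_add free_module_shift free_module_const free_module_basis)
    also have "fps_X ^ (4 * k) * H + fps_const (- c) * fps_X ^ (e + 4 * k) = fps_X ^ n"
      by (simp add: H_def k power_add algebra_simps fps_const_neg[symmetric] del: fps_const_neg)
    finally show ?thesis .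
  qed (use * n in blast)
qed

lemma S_odd_large: "odd n \<Longrightarrow> x1 \<le> n \<Longrightarrow> x3 \<le> n \<Longrightarrow> n \<in> S"
proof -
  assume n: "odd n" "x1 \<le> n" "x3 \<le> n"
  have "n mod 4 = 1 \<or> n mod 4 = 3"
    using n(1) by (simp only: odd_iff_mod_4)
  with n show ?thesis
    unfolding S_def mem_Collect_eq by blast
qed

text \<open>The conditions on \<open>e\<close> ensure that the monomials into which the products of the module
  generators expand lie in the module.\<close>

lemma orders_subalg_eq_S:
  fixes c :: "'a::field" and e :: nat
  defines "H \<equiv> fps_X ^ x2 + fps_const c * fps_X ^ e"
  assumes e: "odd e" "x2 < e" "x2 + e \<in> S" "e + (2 * e - x2) \<in> S"
      "e + (2 * x1 - x2) \<in> S" "e + (2 * x3 - x2) \<in> S"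
      "e mod 4 = 1 \<Longrightarrow> e + (x1 + e - x2) \<in> S" "e mod 4 = 3 \<Longrightarrow> e + (x3 + e - x2) \<in> S"
    and sub: "fps_X ^ 4 \<in> subalg G" "fps_X ^ x1 \<in> subalg G" "H \<in> subalg G" "fps_X ^ x3 \<in> subalg G"
    and G: "G \<subseteq> {fps_X ^ 4, fps_X ^ x1, H, fps_X ^ x3}"
  shows "orders (subalg G) = S"
proof -
  have H: "H \<noteq> 0" "subdegree H = x2"
  proof -
    have nth: "H $ k = (if k = x2 then 1 else 0)" if "k \<le> x2" for k
      using that e(2) by (simp add: H_def)
    then have "H $ x2 \<noteq> 0"
      by simp
    then show "H \<noteq> 0" by auto
    show "subdegree H = x2"
      by (rule subdegreeI) (simp_all add: nth)
  qed
  have mono: "fps_X ^ n \<in> free_module H" if "n \<in> S" "n mod 4 = 2 \<Longrightarrow> e + (n - x2) \<in> S" for n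
    unfolding H_def using that e(1) by (intro fps_X_power_in_free_module)
  have e4: "e mod 4 = 1 \<or> e mod 4 = 3"
    using e(1) by (simp only: odd_iff_mod_4)
  have "odd (x2 + e)"
    using e(1) parity(2) by simp
  then have x2e: "(x2 + e) mod 4 \<noteq> 2"
    unfolding odd_iff_mod_4 by auto
  have mod_e1: "(x1 + e) mod 4 = 2" "(x3 + e) mod 4 = 0" "(e + e) mod 4 = 2" if "e mod 4 = 1"
    by (rule mod_4_add[OF residues(1) that], simp, rule mod_4_add[OF residues(3) that], simp,
        rule mod_4_add[OF that that], simp)
  have mod_e3: "(x1 + e) mod 4 = 0" "(x3 + e) mod 4 = 2" "(e + e) mod 4 = 2" if "e mod 4 = 3"
    by (rule mod_4_add[OF residues(1) that], simp, rule mod_4_add[OF residues(3) that], simp,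
        rule mod_4_add[OF that that], simp)
  have e2: "(e + e) mod 4 = 2"
    using e4 mod_e1(3) mod_e3(3) by blast
  have S0: "n \<in> S" if "n mod 4 = 0" for n
    unfolding S_def mem_Collect_eq using that by (rule disjI1)
  have S2: "n \<in> S" if "n mod 4 = 2" "x2 \<le> n" for n
    unfolding S_def mem_Collect_eq using that by iprover
  have "e + e \<in> S"
    using e2 by (rule S2) (use e(2) in simp)
  have le: "x2 \<le> x1 + e" "x2 \<le> x3 + e"
    using e(2) by simp_all
  have xe: "x1 + e \<in> S" "x3 + e \<in> S"
    using e4 S2[OF mod_e1(1) le(1)] S0[OF mod_e3(1)] S0[OF mod_e1(2)] S2[OF mod_e3(2) le(2)]
    by iprover+
  have x1H: "fps_X ^ x1 * H \<in> free_module H"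
  proof -
    have "fps_X ^ x1 * H = fps_X ^ (x1 + x2) + fps_const c * fps_X ^ (x1 + e)"
      by (simp add: H_def power_add algebra_simps)
    moreover have "fps_X ^ (x1 + x2) \<in> free_module H"
      by (rule mono[OF S_add[OF generators_in_S(2) generators_in_S(3)]]) (use sum_residues in simp)
    moreover have "fps_X ^ (x1 + e) \<in> free_module H"
    proof (rule mono[OF xe(1)])
      assume "(x1 + e) mod 4 = 2"
      then have "e mod 4 = 1"
        using e4 mod_e3(1) by auto
      then show "e + (x1 + e - x2) \<in> S"
        by (rule e)
    qed
    ultimately show ?thesis
      by (simp add: free_module_add free_module_const)
  qed
  have x3H: "fps_X ^ x3 * H \<in> free_module H"
  proof -
    have "fps_X ^ x3 * H = fps_X ^ (x3 + x2) + fps_const c * fps_X ^ (x3 + e)"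
      by (simp add: H_def power_add algebra_simps)
    moreover have "fps_X ^ (x3 + x2) \<in> free_module H"
      by (rule mono[OF S_add[OF generators_in_S(4) generators_in_S(3)]]) (use sum_residues in simp)
    moreover have "fps_X ^ (x3 + e) \<in> free_module H"
    proof (rule mono[OF xe(2)])
      assume "(x3 + e) mod 4 = 2"
      then have "e mod 4 = 3"
        using e4 mod_e1(2) by auto
      then show "e + (x3 + e - x2) \<in> S"
        by (rule e)
    qed
    ultimately show ?thesis
      by (simp add: free_module_add free_module_const)
  qed
  have HH: "H * H \<in> free_module H"
  proof -
    have "H * H = fps_X ^ (x2 + x2) + fps_const (2 * c) * fps_X ^ (x2 + e) + fps_const (c * c) * fps_X ^ (e + e)"
      unfolding H_def fps_const_mult[symmetric] by (simp add: power_add algebra_simps del: fps_const_mult)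
    moreover have "fps_X ^ (x2 + x2) \<in> free_module H"
      by (rule mono[OF S_add[OF generators_in_S(3) generators_in_S(3)]]) (use sum_residues in simp)
    moreover have "fps_X ^ (x2 + e) \<in> free_module H"
      using x2e e(3) by (intro mono) simp_all
    moreover have "fps_X ^ (e + e) \<in> free_module H"
      using \<open>e + e \<in> S\<close> e(4) by (intro mono) (simp_all add: mult_2)
    ultimately show ?thesis
      by (simp only: free_module_add free_module_const)
  qed
  have x11: "fps_X ^ (x1 + x1) \<in> free_module H" and x33: "fps_X ^ (x3 + x3) \<in> free_module H"
    using mono[OF S_add[OF generators_in_S(2,2)]] mono[OF S_add[OF generators_in_S(4,4)]] e(5,6)
    by (simp_all add: mult_2)
  have x13: "fps_X ^ (x1 + x3) \<in> free_module H"
      by (rule mono[OF S_add[OF generators_in_S(2) generators_in_S(4)]]) (use sum_residues in simp)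
  note mult = free_module_mult[OF x11[unfolded power_add] x1H x13[unfolded power_add] HH x3H
      x33[unfolded power_add]]
  have "G \<subseteq> free_module H"
    using G free_module_basis[of H] free_module_shift[OF free_module_basis(1), of 1 H] by auto
  \<comment> \<open>The module contains the generators and is closed under products, so it contains
    the algebra; this excludes orders outside \<open>S\<close>.\<close>
  have subset: "u \<in> free_module H" if "u \<in> subalg G" for u
    using that
  proof (induction rule: subalg.induct)
    case (const a)
    show ?case
      using free_module_const[OF free_module_basis(1), of a H] by simp
  next
    case (gen F)
    then show ?case
      using \<open>G \<subseteq> free_module H\<close> by blast
  qed (simp_all add: free_module_add mult)
  show ?thesis
  proof (intro equalityI subsetI)
    fix n assume "n \<in> orders (subalg G)"
    then obtain u where "u \<in> subalg G" "u \<noteq> 0" "subdegree u = n"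
      by (rule ordersE)
    then show "n \<in> S"
      using order_in_free_module[OF H subset, of u] by simp
  next
    fix n assume "n \<in> S"
    then obtain k y where y: "y \<in> {0, x1, x2, x3}" "n = k * 4 + y"
      by (rule S_cases)
    have "4 \<in> orders (subalg G)" "x1 \<in> orders (subalg G)" "x2 \<in> orders (subalg G)" "x3 \<in> orders (subalg G)"
      using ordersI[OF sub(1)] ordersI[OF sub(2)] ordersI[OF sub(3) H(1)] ordersI[OF sub(4)] H(2)
      by (simp_all add: subdegree_power)
    then show "n \<in> orders (subalg G)"
      unfolding y(2) using y(1) by (auto intro!: orders_subalg_add orders_subalg_mult orders_subalg_0)
  qed
qed

end

section \<open>Realizing semigroups by well-parameterized curves\<close>

text \<open>Dividing \<open>t^n\<close> by a power of \<open>t^4\<close> leaves \<open>t\<close> or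
  \<open>t^3\<close>, and in the second case \<open>t\<close> is \<open>t^4 / t^3\<close>.\<close>

lemma eq_of_coprime_powers_eq:
  fixes s t :: complex
  assumes "t ^ 4 = s ^ 4" "t ^ n = s ^ n" "odd n"
  shows "t = s"
proof (cases "s = 0")
  case True
  then show ?thesis using assms(1) by simp
next
  case False
  then have nz: "t \<noteq> 0"
    using assms(1) by auto
  define k where "k = n div 4"
  have k: "t ^ (4 * k) = s ^ (4 * k)"
    using assms(1) by (simp add: power_mult)
  have nz': "s ^ (4 * k) \<noteq> 0"
    using False by simp
  have "n mod 4 = 1 \<or> n mod 4 = 3"
    using assms(3) by (simp only: odd_iff_mod_4)
  then have "n = 4 * k + 1 \<or> n = 4 * k + 3"
    unfolding k_def by presburger
  then show ?thesis
  proof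
    assume "n = 4 * k + 1"
    then show ?thesis
      using assms(2) k nz' False by (simp add: power_add)
  next
    assume "n = 4 * k + 3"
    then have cube: "t ^ 3 = s ^ 3"
      using assms(2) k nz' False by (simp add: power_add)
    have "t * t ^ 3 = s * s ^ 3"
      using assms(1) by (simp flip: power_Suc)
    then show ?thesis
      using cube False by simp
  qed
qed

text \<open>The predicate whose least \<open>d\<close> is \<open>min_embedding_dim\<close>.\<close>

definition realizes :: "nat \<Rightarrow> nat set \<Rightarrow> bool" where
  "realizes d S \<longleftrightarrow> (\<exists>c. curve d c \<and> well_parameterized d c \<and> curve_semigroup d c = S)"

text \<open>The components \<open>t^4\<close> and \<open>t^n\<close> with \<open>n\<close> odd
  separate points, which gives well-parameterization; the semigroup is read off from the Taylor
  series.\<close>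

lemma realizesI:
  fixes c :: "nat \<Rightarrow> complex \<Rightarrow> complex"
  assumes d: "2 \<le> d" and c: "\<And>t. c 0 t = t ^ 4" "\<And>t. c 1 t = t ^ n" "odd n"
    and C: "\<And>i. i < d \<Longrightarrow> c i has_fps_expansion C i" "\<And>i. i < d \<Longrightarrow> C i $ 0 = 0"
    and S: "orders (subalg (C ` {..<d})) = S"
  shows "realizes d S"
proof -
  have "inj_on (\<lambda>t. \<lambda>i\<in>{..<d}. c i t) (ball 0 1)"
  proof (rule inj_onI)
    fix t s assume eq: "(\<lambda>i\<in>{..<d}. c i t) = (\<lambda>i\<in>{..<d}. c i s)"
    have "c 0 t = c 0 s" "c 1 t = c 1 s"
      using fun_cong[OF eq, of 0] fun_cong[OF eq, of 1] d by simp_all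
    then show "t = s"
      using eq_of_coprime_powers_eq[of t s n] c by simp
  qed
  then have "well_parameterized d c"
    unfolding well_parameterized_def using zero_less_one by blast
  moreover have "curve d c"
  proof -
    have "\<not> (\<forall>\<^sub>F t in nhds 0. \<forall>i<d. c i t = 0)"
    proof
      assume "\<forall>\<^sub>F t in nhds 0. \<forall>i<d. c i t = 0"
      then have "\<forall>\<^sub>F t in at 0. \<forall>i<d. c i t = 0"
        by (simp add: eventually_nhds_conv_at)
      moreover have "\<forall>\<^sub>F t in at (0::complex). t \<noteq> 0"
        by (simp add: eventually_at_filter)
      ultimately have "\<forall>\<^sub>F t in at (0::complex). False"
      proof eventually_elim
        case (elim t)
        then have "c 0 t = 0"
          using d by auto
        with elim(2) c(1) show False by simp
      qed
      then show False
        by simp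
    qed
    moreover have "c i analytic_on {0}" "c i 0 = 0" if "i < d" for i
      using has_fps_expansion_imp_analytic_0[OF C(1)[OF that]]
        has_fps_expansion_imp_0_eq_fps_nth_0[OF C(1)[OF that]] C(2)[OF that] by simp_all
    ultimately show ?thesis
      unfolding curve_def by blast
  qed
  moreover have "curve_semigroup d c = S"
    using curve_semigroup_eq_orders[where c = c and C = C and d = d, OF C] S by simp
  ultimately show ?thesis
    unfolding realizes_def by blast
qed

lemma realizes_imp_orders:
  assumes "realizes d S"
  shows "\<exists>C :: nat \<Rightarrow> complex fps. (\<forall>i<d. C i $ 0 = 0) \<and> orders (subalg (C ` {..<d})) = S"
proof -
  obtain c where c: "curve d c" "curve_semigroup d c = S"
    using assms unfolding realizes_def by blast
  define C where "C = (\<lambda>i. fps_expansion (c i) 0)"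
  have an: "c i analytic_on {0}" "c i 0 = 0" if "i < d" for i
    using c(1) that unfolding curve_def by auto
  then have C: "c i has_fps_expansion C i" if "i < d" for i
    unfolding C_def using that by (intro analytic_at_imp_has_fps_expansion_0)
  then have C0: "C i $ 0 = 0" if "i < d" for i
    using has_fps_expansion_imp_0_eq_fps_nth_0[OF C[OF that]] an(2)[OF that] that by simp
  have "orders (subalg (C ` {..<d})) = S"
    using curve_semigroup_eq_orders[where c = c and C = C and d = d, OF C C0] c(2) by simp
  with C0 show ?thesis
    by blast
qed

section \<open>Curves in dimensions four and three\<close>

context four_generated
begin

lemma realizes_four: "realizes 4 S"
proof -
  define c :: "nat \<Rightarrow> complex \<Rightarrow> complex"
    where "c = (\<lambda>i t. if i = 0 then t ^ 4 else if i = 1 then t ^ x1 else if i = 2 then t ^ x2 else t ^ x3)"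
  define C :: "nat \<Rightarrow> complex fps"
    where "C = (\<lambda>i. if i = 0 then fps_X ^ 4 else if i = 1 then fps_X ^ x1 else if i = 2 then fps_X ^ x2 else fps_X ^ x3)"
  have img: "C ` {..<4} = {fps_X ^ 4, fps_X ^ x1, fps_X ^ x2, fps_X ^ x3}"
  proof -
    have "{..<4::nat} = {0, 1, 2, 3}" by auto
    then show ?thesis
      by (auto simp: C_def)
  qed
  \<comment> \<open>With \<open>c = 0\<close> the curve is monomial, and \<open>e\<close> only has
    to meet the membership conditions: the exponents in them are odd and at least \<open>x1\<close>
    and \<open>x3\<close>.\<close>
  define e where "e = 4 * (x1 + x2 + x3) + 1"
  have ord: "orders (subalg (C ` {..<4})) = S"
    by (rule orders_subalg_eq_S[where c = 0 and e = e])
      (use parity in \<open>auto simp: img e_def intro!: S_odd_large\<close>)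
  show ?thesis
  proof (rule realizesI[OF _ _ _ parity(1) _ _ ord])
    show "c i has_fps_expansion C i" for i
      unfolding c_def C_def by (auto intro!: has_fps_expansion_fps_X_power)
    show "C i $ 0 = 0" for i
      using big by (simp add: C_def)
  qed (simp_all add: c_def)
qed

text \<open>The congruence modulo 4 is given by witnesses on both sides, so that later checks are
  linear and free of subtraction.\<close>

lemma S_cong:
  assumes "y \<in> S" "y \<le> n" "n + 4 * i = y + 4 * j"
  shows "n \<in> S"
proof -
  have "n mod 4 = y mod 4"
    using assms(3) by (metis mod_mult_self2)
  then show ?thesis
    using assms(1,2) unfolding S_def mem_Collect_eq by (elim disjE conjE) simp_all
qed

lemma odd_generators:
  assumes "{y, z} = {x1, x3}"
  shows "y = x1 \<and> z = x3 \<or> y = x3 \<and> z = x1"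
    "y \<in> S" "z \<in> S" "odd y" "odd z" "(y + z) mod 4 = 0" "x2 < 2 * y"
proof -
  show yz: "y = x1 \<and> z = x3 \<or> y = x3 \<and> z = x1"
    using assms by (auto simp: doubleton_eq_iff)
  then show "y \<in> S" "z \<in> S" "x2 < 2 * y"
    using generators_in_S indecomposable by auto
  from yz show "odd y" "odd z" "(y + z) mod 4 = 0"
    using parity sum_residues(2) by (auto simp: add.commute)
qed

text \<open>The curve is \<open>(t^4, t^y, t^x2 + k * t^e)\<close>. The generator \<open>z\<close>
  is not the order of a component; the last hypothesis recovers \<open>t^z\<close> as a polynomial
  in the components, after which the module argument applies.\<close>

lemma realizes_three:
  assumes yz: "{y, z} = {x1, x3}" and e: "odd e" "x2 < e" "x2 + e \<in> S" "\<And>n. n + x2 = 3 * e \<Longrightarrow> n \<in> S"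
      "\<And>n. n + x2 = e + 2 * y \<Longrightarrow> n \<in> S" "\<And>n. n + x2 = e + 2 * z \<Longrightarrow> n \<in> S"
      "\<And>n. n + x2 = y + 2 * e \<Longrightarrow> e mod 4 = y mod 4 \<Longrightarrow> n \<in> S"
      "\<And>n. n + x2 = z + 2 * e \<Longrightarrow> e mod 4 = z mod 4 \<Longrightarrow> n \<in> S"
    and z: "fps_X ^ z \<in> subalg {fps_X ^ 4, fps_X ^ y, fps_X ^ x2 + fps_const (k :: complex) * fps_X ^ e}"
  shows "realizes 3 S"
proof -
  define H where "H = fps_X ^ x2 + fps_const k * fps_X ^ e"
  define c :: "nat \<Rightarrow> complex \<Rightarrow> complex"
    where "c = (\<lambda>i t. if i = 0 then t ^ 4 else if i = 1 then t ^ y else t ^ x2 + k * t ^ e)"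
  define C :: "nat \<Rightarrow> complex fps"
    where "C = (\<lambda>i. if i = 0 then fps_X ^ 4 else if i = 1 then fps_X ^ y else H)"
  have img: "C ` {..<3} = {fps_X ^ 4, fps_X ^ y, H}"
  proof -
    have "{..<3::nat} = {0, 1, 2}" by auto
    then show ?thesis
      by (auto simp: C_def)
  qed
  note y' = odd_generators(1)[OF yz]
  have e4: "e + (2 * e - x2) \<in> S"
    by (rule e(4)) (use e(2) in simp)
  have e5: "e + (2 * x1 - x2) \<in> S"
    using y' e(5)[of "e + (2 * x1 - x2)"] e(6)[of "e + (2 * x1 - x2)"] indecomposable by auto
  have e6: "e + (2 * x3 - x2) \<in> S"
    using y' e(5)[of "e + (2 * x3 - x2)"] e(6)[of "e + (2 * x3 - x2)"] indecomposable by auto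
  have e7: "e + (x1 + e - x2) \<in> S" if "e mod 4 = 1"
    using y' e(2) e(7)[of "e + (x1 + e - x2)"] e(8)[of "e + (x1 + e - x2)"] that residues by auto
  have e8: "e + (x3 + e - x2) \<in> S" if "e mod 4 = 3"
    using y' e(2) e(7)[of "e + (x3 + e - x2)"] e(8)[of "e + (x3 + e - x2)"] that residues by auto
  have "fps_X ^ z \<in> subalg (C ` {..<3})"
    using z by (simp add: img H_def)
  moreover have gens: "fps_X ^ 4 \<in> subalg (C ` {..<3})" "fps_X ^ y \<in> subalg (C ` {..<3})" "H \<in> subalg (C ` {..<3})"
    unfolding img by (auto intro: subalg.gen)
  ultimately have sub: "fps_X ^ x1 \<in> subalg (C ` {..<3})" "fps_X ^ x3 \<in> subalg (C ` {..<3})"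
    using y' by auto
  have ord: "orders (subalg (C ` {..<3})) = S"
  proof (rule orders_subalg_eq_S[where c = k and e = e, folded H_def])
    show "C ` {..<3} \<subseteq> {fps_X ^ 4, fps_X ^ x1, H, fps_X ^ x3}"
      using y' unfolding img by auto
  qed (fact e(1-3) e4 e5 e6 e7 e8 gens sub)+
  have "odd y"
    using y' parity by auto
  then have "y \<noteq> 0"
    using odd_pos[of y] by simp
  show ?thesis
  proof (rule realizesI[OF _ _ _ \<open>odd y\<close> _ _ ord])
    show "c i has_fps_expansion C i" for i
      unfolding c_def C_def H_def
      by (auto intro!: has_fps_expansion_fps_X_power has_fps_expansion_add has_fps_expansion_mult has_fps_expansion_const)
    show "C i $ 0 = 0" for i
      using \<open>y \<noteq> 0\<close> big e(2) by (simp add: C_def H_def)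
  qed (simp_all add: c_def)
qed

text \<open>Here the relation of value \<open>2 * y\<close> is deformed:
  the difference of \<open>(t ^ y) ^ 2\<close> and \<open>t ^ (2 * y - x2)\<close> times the third
  coordinate is \<open>t ^ z\<close>.\<close>

lemma realizes_three_odd_min:
  assumes yz: "{y, z} = {x1, x3}" "y < x2" "2 * y < z"
  shows "realizes 3 S"
proof -
  \<comment> \<open>Multiplying the third coordinate by \<open>t^(2 * y - x2)\<close> moves its term
    \<open>t^e\<close> to \<open>t^z\<close>.\<close>
  define e where "e = z - (2 * y - x2)"
  note y = odd_generators[OF yz(1)]
  obtain b where b: "x2 = 4 * b + 2"
    using residues(2) by (metis mult_div_mod_eq)
  obtain p where p: "y = 2 * p + 1"
    using y(4) by (rule oddE)
  obtain q where q: "z = 2 * q + 1"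
    using y(5) by (rule oddE)
  obtain w where w: "y + z = 4 * w"
    using y(6) by (rule mod_0_imp_dvd[THEN dvdE])
  have "\<exists>k. 2 * y = x2 + 4 * k"
    using y(7) b p by (intro exI[of _ "p - b"]) (simp add: diff_mult_distrib2)
  then obtain k where k: "2 * y = x2 + 4 * k" ..
  have e: "e + 4 * k = z"
    using k yz(3) by (simp add: e_def)
  have lt: "x2 < e"
    using e k yz(3) by linarith
  show ?thesis
  proof (rule realizes_three[OF yz(1), where e = e and k = "-1"])
    show "odd e"
      using y(5) unfolding e[symmetric] by simp
    show "x2 < e"
      by (rule lt)
    \<comment> \<open>With \<open>x2 + 4 * k = 2 * y\<close> and \<open>e + 4 * k = z\<close>,
      adding \<open>8 * k\<close> to \<open>x2 + e\<close> gives
      \<open>2 * y + z = y + 4 * w\<close>.\<close>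
    show "x2 + e \<in> S"
      by (rule S_cong[OF y(2), of _ "2 * k" w]) (use yz k e w in \<open>simp_all add: distrib_left\<close>)
    show "n \<in> S" if "n + x2 = 3 * e" for n
      by (rule S_cong[OF y(3), of _ "3 * k + b" q]) (use yz b k e q lt that in \<open>simp_all add: distrib_left\<close>)
    show "n \<in> S" if "n + x2 = e + 2 * y" for n
      using y(3) k e that by simp
    show "n \<in> S" if "n + x2 = e + 2 * z" for n
      by (rule S_cong[OF y(3), of _ "k + b" q]) (use b e q lt that in \<open>simp_all add: distrib_left\<close>)
    \<comment> \<open>This case is void: \<open>e\<close> is congruent to \<open>z\<close> modulo 4,
      and \<open>y + z\<close> is divisible by 4 with \<open>y\<close> odd.\<close>
    show "n \<in> S" if "n + x2 = y + 2 * e" "e mod 4 = y mod 4" for n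
    proof -
      have "y mod 4 = z mod 4"
        using that(2) e by auto
      then have False
        using y(4,6) by presburger
      then show ?thesis ..
    qed
    show "n \<in> S" if "n + x2 = z + 2 * e" for n
      by (rule S_cong[OF y(3), of _ "2 * k + b" q]) (use b e q lt that in \<open>simp_all add: distrib_left\<close>)
    let ?H = "fps_X ^ x2 + fps_const (- 1) * fps_X ^ e :: complex fps"
    have "fps_X ^ z = (fps_X ^ y) ^ 2 - (fps_X ^ 4) ^ k * ?H"
    proof -
      have "2 * y = 4 * k + x2" "z = 4 * k + e"
        using k e by simp_all
      then show ?thesis
        by (simp add: algebra_simps flip: power_mult power_add mult_2_right fps_const_neg)
    qed
    also have "\<dots> \<in> subalg {fps_X ^ 4, fps_X ^ y, ?H}"
    proof -
      have "g ^ 2 - f ^ k * H \<in> subalg G"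
        if "f \<in> subalg G" "g \<in> subalg G" "H \<in> subalg G" for f g H :: "complex fps" and G
        using that by (intro subalg_diff subalg.mult subalg_power)
      then show ?thesis
        by (simp only: subalg.gen insertI1 insertI2)
    qed
    finally show "fps_X ^ z \<in> subalg {fps_X ^ 4, fps_X ^ y, ?H}" .
  qed
qed

text \<open>Here the relation of value \<open>2 * x2\<close> is deformed: the square of
  \<open>t ^ x2 + t ^ (z - x2)\<close> contains \<open>2 * t ^ z\<close>, and its other terms lie in the algebra.\<close>

lemma realizes_three_even_min:
  assumes yz: "{y, z} = {x1, x3}" "x2 < y" "y < z" "2 * x2 < z"
  shows "realizes 3 S"
proof -
  define e where "e = z - x2"
  note y = odd_generators[OF yz(1)]
  obtain b where b: "x2 = 4 * b + 2"
    using residues(2) by (metis mult_div_mod_eq)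
  obtain p where p: "y = 2 * p + 1"
    using y(4) by (rule oddE)
  obtain q where q: "z = 2 * q + 1"
    using y(5) by (rule oddE)
  obtain w where w: "y + z = 4 * w"
    using y(6) by (rule mod_0_imp_dvd[THEN dvdE])
  have e: "e + x2 = z"
    using yz by (simp add: e_def)
  have lt: "x2 < e"
    using e yz(4) by linarith
  have l: "x2 + x2 = 4 * (2 * b + 1)"
    by (simp add: b)
  \<comment> \<open>The term \<open>t^(2 * e)\<close> of the square is removed by
    \<open>t^(4 * j)\<close> times the third coordinate, at the cost of
    \<open>t^(e + 4 * j)\<close>.\<close>
  have "\<exists>j. e + e = x2 + 4 * j"
    using b q e lt by (intro exI[of _ "q - 3 * b - 1"]) linarith
  then obtain j where j: "e + e = x2 + 4 * j" ..
  \<comment> \<open>The new exponent is \<open>3 * z - 4 * x2\<close>, congruent to \<open>y\<close>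
    modulo 4 because \<open>y + z\<close> is divisible by 4; it is at least \<open>y\<close> since
    \<open>z > y\<close> and \<open>z > 2 * x2\<close>.\<close>
  have "\<exists>m. e + 4 * j = 4 * m + y"
    using b e lt j w yz(3) by (intro exI[of _ "3 * w - (y + 4 * b + 2)"]) linarith
  then obtain m where m: "e + 4 * j = 4 * m + y" ..
  show ?thesis
  proof (rule realizes_three[OF yz(1), where e = e and k = 1])
    show "odd e"
      using y(5) parity(2) unfolding e[symmetric] by simp
    show "x2 < e"
      by (rule lt)
    show "x2 + e \<in> S"
      using y(3) e by (simp add: add.commute)
    show "n \<in> S" if "n + x2 = 3 * e" for n
      by (rule S_cong[OF y(2), of _ "y + 4 * b + 2" "3 * w"]) (use b e w lt yz(3) that in \<open>simp_all add: distrib_left\<close>)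
    show "n \<in> S" if "n + x2 = e + 2 * y" for n
      by (rule S_cong[OF y(2), of _ "2 * b + 1" w]) (use b e w lt y(7) that in \<open>simp_all add: distrib_left\<close>)
    show "n \<in> S" if "n + x2 = e + 2 * z" for n
      by (rule S_cong[OF y(2), of _ "y + 2 * b + 1" "3 * w"]) (use b e w lt yz(3) that in \<open>simp_all add: distrib_left\<close>)
    show "n \<in> S" if "n + x2 = y + 2 * e" for n
      by (rule S_cong[OF y(2), of _ "p + 3 * b + 2" "2 * w"]) (use b e w p lt that in \<open>simp_all add: distrib_left\<close>)
    \<comment> \<open>This case is void, because \<open>e = z - x2\<close> and \<open>x2\<close> is
      2 modulo 4.\<close>
    show "n \<in> S" if "n + x2 = z + 2 * e" "e mod 4 = z mod 4" for n
    proof -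
      have False
        using that(2) e residues(2) by presburger
      then show ?thesis ..
    qed
    let ?H = "fps_X ^ x2 + fps_const 1 * fps_X ^ e :: complex fps"
    have "?H * ?H = fps_X ^ (x2 + x2) + fps_const 2 * fps_X ^ (e + x2) + fps_X ^ (e + e)"
      by (simp add: power_add algebra_simps numeral_fps_const)
    moreover have "(fps_X ^ 4) ^ j * ?H = fps_X ^ (e + e) + fps_X ^ (e + 4 * j)"
      unfolding j by (simp add: power_add algebra_simps flip: power_mult)
    ultimately have "fps_const (1 / 2) * (?H * ?H - (fps_X ^ 4) ^ (2 * b + 1) - (fps_X ^ 4) ^ j * ?H + (fps_X ^ 4) ^ m * fps_X ^ y)
        = fps_const (1 / 2) * (fps_const 2 * fps_X ^ z)"
      unfolding l m e by (simp add: power_add power_mult)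
    also have "\<dots> = fps_X ^ z"
      by (simp flip: mult.assoc)
    finally have "fps_X ^ z = fps_const (1 / 2) * (?H * ?H - (fps_X ^ 4) ^ (2 * b + 1) - (fps_X ^ 4) ^ j * ?H + (fps_X ^ 4) ^ m * fps_X ^ y)" ..
    also have "\<dots> \<in> subalg {fps_X ^ 4, fps_X ^ y, ?H}"
    proof -
      have "fps_const (1 / 2) * (H * H - f ^ (2 * b + 1) - f ^ j * H + f ^ m * g) \<in> subalg G"
        if "f \<in> subalg G" "g \<in> subalg G" "H \<in> subalg G" for f g H :: "complex fps" and G
        using that by (intro subalg_diff subalg.add subalg.mult subalg_power subalg.const)
      then show ?thesis
        by (simp only: subalg.gen insertI1 insertI2)
    qed
    finally show "fps_X ^ z \<in> subalg {fps_X ^ 4, fps_X ^ y, ?H}" .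
  qed
qed

text \<open>Without the gap all four generators lie below twice the minimum and need four
  components. With it, the deformation is chosen by the parity of the minimum.\<close>

lemma realizes_three_iff: "realizes 3 S \<longleftrightarrow> 2 * Min {x1, x2, x3} < Max {x1, x2, x3}"
proof
  assume "realizes 3 S"
  then obtain C :: "nat \<Rightarrow> complex fps" where C: "\<forall>i<3. C i $ 0 = 0"
    "orders (subalg (C ` {..<3})) = S"
    using realizes_imp_orders by blast
  show "2 * Min {x1, x2, x3} < Max {x1, x2, x3}"
  proof (rule ccontr)
    assume le: "\<not> 2 * Min {x1, x2, x3} < Max {x1, x2, x3}"
    have "j < 2 * Min {x1, x2, x3}" if "j \<in> {4, x1, x2, x3}" for j
    proof -
      have j: "j \<le> 2 * x1" "j \<le> 2 * x2" "j \<le> 2 * x3"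
        using le that big by (auto simp: not_less)
      \<comment> \<open>Equality is impossible: odd generators are not even, \<open>x2\<close> is
        less than \<open>2 * x1\<close> and \<open>2 * x3\<close>, and 4 is too small.\<close>
      have "j \<noteq> 2 * x1" "j \<noteq> 2 * x2" "j \<noteq> 2 * x3"
        using that indecomposable big parity by (elim insertE; force)+
      with j show ?thesis by auto
    qed
    with C(1)[rule_format] C(2) subset_refl have "card {4, x1, x2, x3} \<le> 3"
      by (rule card_generators_le)
    moreover have "card {4, x1, x2, x3} = 4"
      using big residues by (auto simp: card_insert_if)
    ultimately show False by simp
  qed
next
  assume gap: "2 * Min {x1, x2, x3} < Max {x1, x2, x3}"
  have ne: "x1 \<noteq> x2" "x1 \<noteq> x3" "x2 \<noteq> x3"
    using residues by auto
  \<comment> \<open>The bounds \<open>x2 < 2 * x1\<close> and \<open>x2 < 2 * x3\<close> keep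
    \<open>x2\<close> from being the maximum, so the larger odd generator is; the minimum is the
    other odd one or \<open>x2\<close>.\<close>
  have "(x1 < x2 \<and> 2 * x1 < x3) \<or> (x3 < x2 \<and> 2 * x3 < x1)
    \<or> (x2 < x1 \<and> x1 < x3 \<and> 2 * x2 < x3) \<or> (x2 < x3 \<and> x3 < x1 \<and> 2 * x2 < x1)"
    using gap ne indecomposable by (auto simp: min_def max_def split: if_splits)
  then show "realizes 3 S"
    using realizes_three_odd_min[of x1 x3] realizes_three_odd_min[of x3 x1]
      realizes_three_even_min[of x1 x3] realizes_three_even_min[of x3 x1]
    by (auto simp: insert_commute)
qed

text \<open>The generators 4 and \<open>\<mu>\<close> lie below \<open>2 * \<mu>\<close> and force
  two components; exactly two are excluded by \<open>not_plane\<close>.\<close>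

lemma realizes_ge_three:
  assumes "realizes d S"
  shows "3 \<le> d"
proof -
  obtain C :: "nat \<Rightarrow> complex fps" where C: "\<forall>i<d. C i $ 0 = 0"
    "orders (subalg (C ` {..<d})) = S"
    using realizes_imp_orders[OF assms] by blast
  define \<mu> where "\<mu> = Min {x1, x2, x3}"
  have \<mu>: "\<mu> \<in> {x1, x2, x3}"
    unfolding \<mu>_def by (rule Min_in) simp_all
  have "card {4, \<mu>} \<le> d"
    using \<mu> big
    by (intro card_generators_le[OF C(1)[rule_format] C(2)]) (auto simp: \<mu>_def[symmetric])
  moreover have "card {4, \<mu>} = 2"
    using \<mu> big by auto
  moreover have "d \<noteq> 2"
    using not_plane C by blast
  ultimately show ?thesis by simp
qed

lemma min_embedding_dim_eq_three_iff:
  "min_embedding_dim S = 3 \<longleftrightarrow> 2 * Min {x1, x2, x3} < Max {x1, x2, x3}"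
proof -
  have eq: "min_embedding_dim S = (LEAST d. realizes d S)"
    unfolding min_embedding_dim_def realizes_def ..
  \<comment> \<open>The least dimension is attained because dimension four is; hence its being 3
    yields \<open>realizes 3 S\<close>.\<close>
  have "realizes (LEAST d. realizes d S) S"
    using realizes_four by (rule LeastI)
  moreover have "(LEAST d. realizes d S) = 3" if "realizes 3 S"
    using that realizes_ge_three by (rule Least_equality)
  ultimately show ?thesis
    unfolding eq realizes_three_iff[symmetric] by auto
qed

end

theorem theorem1p1:
  fixes x1 x2 x3 :: nat and S :: "nat set"
  assumes "x1 > 4" and "x2 > 4" and "x3 > 4"
    and "[x1 = 1] (mod 4)" and "[x2 = 2] (mod 4)" and "[x3 = 3] (mod 4)"
    and "S = sg_gen {4, x1, x2, x3}"
    and "embedding_dim S = 4"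
  shows "min_embedding_dim S = 3 \<longleftrightarrow>
    Max {x1, x2, x3} \<noteq> x2 \<and> Max {x1, x2, x3} > 2 * Min {x1, x2, x3}"
proof -
  note ineqs = embedding_dim_four_imp[OF assms(4-6) assms(8)[unfolded assms(7)]]
  interpret fg: four_generated x1 x2 x3
    using assms(1-6) ineqs by unfold_locales (simp_all add: cong_def)
  \<comment> \<open>If \<open>x2\<close> were the maximum, the gap would put \<open>x2\<close> above
    \<open>2 * x1\<close> or \<open>2 * x3\<close>, against the inequalities.\<close>
  have "Max {x1, x2, x3} \<noteq> x2" if "Max {x1, x2, x3} > 2 * Min {x1, x2, x3}"
    using that fg.indecomposable by (auto simp: min_def max_def split: if_splits)
  moreover have "min_embedding_dim S = 3 \<longleftrightarrow> 2 * Min {x1, x2, x3} < Max {x1, x2, x3}"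
    using fg.min_embedding_dim_eq_three_iff fg.sg_gen_eq_S assms(7) by simp
  ultimately show ?thesis
    by blast
qed

end
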